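(* Let $\mathbb{F}\in\{\mathbb{R},\mathbb{C}\}$, $n\in\mathbb{N}$, $r,m\in\mathbb{Z}_+$, let $\mathcal{A}\in\mathbb{F}^{n\times n}/{\sim}$ and $\mathcal{C}\in\mathbb{F}^{m\times n}/{\sim}$ be nonzero patterns, and let $t_0,t_1\in\mathbb{Z}$ with $t_0<t_1$. Put $N=t_1-t_0$ and define the pattern $\mathcal{K}\in\mathbb{F}^{nN\times(n+m)N}/{\sim}$ by $$ \mathcal{K}= \begin{pmatrix} [0]_{\sim} & [\mathrm{id}]_{\sim} & & & \mathcal{C}^{\ast} & & & \\ & \mathcal{A}^{\ast} & \ddots & & & \mathcal{C}^{\ast} & & \\ & & \ddots & [\mathrm{id}]_{\sim} & & & \ddots & \\ & & & \mathcal{A}^{\ast} & & & & \mathcal{C}^{\ast} \end{pmatrix}, $$ that is, $\mathcal{K}$ has $N$ block rows of height $n$, followed across by $N$ block columns of width $n$ (numbered $1,\dots,N$) and then $N$ block columns of width $m$ (numbered $N+1,\dots,2N$); the block at position $(i,i+1)$ is $[\mathrm{id}]_{\sim}$ for $1\le i\le N-1$, the block at position $(i,i)$ is $\mathcal{A}^{\ast}$ for $2\le i\le N$, the block at position $(i,N+i)$ is $\mathcal{C}^{\ast}$ for $1\le i\le N$, and all other blocks (in particular the entire first block column) are zero patterns of suitable sizes. Then every discrete-time system $x(t+1)=A(t)x(t)+B(t)u(t)$, $y(t)=C(t)x(t)+D(t)u(t)$ of output pattern $(\mathcal{A},\mathcal{C})$ is observable on $[t_0,t_1]$ if and only if the following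 condition holds: ($G_3^{\ast}$) For every non-empty subset $V\subseteq\{1,\dots,n(t_1-t_0)\}$ of vertices of the graph $\mathcal{G}(\mathcal{K})$ there exists some vertex $v\in\{1,\dots,(n+m)(t_1-t_0)\}$ such that $V$ contains exactly one successor of $v$ in $\mathcal{G}(\mathcal{K})$. Moreover, under the additional assumption $t_0+n\le t_1$, condition ($G_3^{\ast}$) is equivalent to each of the following two statements. (i) Every time-invariant discrete-time system $x(t+1)=A(t)x(t)+B(t)u(t)$, $y(t)=C(t)x(t)+D(t)u(t)$ of output pattern $(\mathcal{A},\mathcal{C})$ is observable. (ii) Both of the following conditions hold for the graph $\mathcal{G}(\mathcal{A}^{\ast},\mathcal{C}^{\ast})$: (a) for every non-empty subset $V\subseteq\{1,\dots,n\}$ of vertices there exists a vertex $v\in\{1,\dots,n+m\}$ such that $V\cap\mathrm{Post}(\{v\})$ is a singleton; (b) for every non-empty subset $V\subseteq\{1,\dots,n\}$ of vertices that satisfies $V\subseteq\mathrm{Pre}(V)$ there exists a vertex $v\in\{1,\dots,n+m\}\setminus V$ such that $V\cap\mathrm{Post}(\{v\})$ is a singleton.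
   Context: $\mathbb{Z}_+$ is the set of non-negative integers, $\mathbb{N}=\mathbb{Z}_+\setminus\{0\}$, and intervals in the discrete-time setting are intervals of integers. Nonzero patterns: for $X,Y\in\mathbb{F}^{p\times q}$ write $X\sim Y$ iff the positions of the zero entries of $X$ and $Y$ coincide. The equivalence classes $[X]_{\sim}\in\mathbb{F}^{p\times q}/{\sim}$ are called (nonzero) patterns; a pattern is represented by a matrix of symbols $\star$ (nonzero entry) and $\circ$ (zero entry). $\mathrm{id}$ is the $n\times n$ identity matrix. Juxtaposition and transposition of patterns are defined by $([X]_{\sim},[Y]_{\sim})=[(X,Y)]_{\sim}$ and $[X]_{\sim}^{\ast}=[X^{\ast}]_{\sim}$, where $X^{\ast}$ is the transpose of $X$ if $\mathbb{F}=\mathbb{R}$ and the conjugate transpose if $\mathbb{F}=\mathbb{C}$. Graphs: for a pattern $\mathcal{M}$ of size $p\times q$ with $p\le q$, the directed graph $\mathcal{G}(\mathcal{M})$ has vertices $1,\dots,q$, and there is an edge from vertex $v$ to vertex $w$ iff $1\le w\le p$ and $\mathcal{M}_{w,v}=\star$. In that case $w$ is a successor of $v$ and $v$ is a predecessor of $w$. $\mathcal{G}(\mathcal{A}^{\ast},\mathcal{C}^{\ast})$ is the graph of the $n\times(n+m)$ pattern $(\mathcal{A}^{\ast},\mathcal{C}^{\ast})$. For a set $V$ of vertices, $\mathrm{Pre}(V)$ is the set of all predecessors of vertices in $V$, and $\mathrm{Post}(V)$ is the set of all successors of vertices in $V$. Systems: a discrete-time system $x(t+1)=A(t)x(t)+B(t)u(t)$,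 $y(t)=C(t)x(t)+D(t)u(t)$ over $\mathbb{F}$ is given by coefficient matrices $A(t)\in\mathbb{F}^{n\times n}$, $B(t)\in\mathbb{F}^{n\times r}$, $C(t)\in\mathbb{F}^{m\times n}$, $D(t)\in\mathbb{F}^{m\times r}$ for all $t\in\mathbb{Z}$. It is time-invariant if these matrices are all constant. It is of output pattern $(\mathcal{A},\mathcal{C})$ if $A(t)\in\mathcal{A}$ and $C(t)\in\mathcal{C}$ for all $t\in\mathbb{Z}$. For $x_0\in\mathbb{F}^n$, initial time $t_0$ and input $u$, $\varphi(\cdot,t_0,x_0,u)$ denotes the unique solution $x$ on $\{t\in\mathbb{Z}:t\ge t_0\}$ with $\varphi(t_0,t_0,x_0,u)=x_0$; its value at $t$ depends only on $u$ restricted to $[t_0,t)$. Observability: for integers $\tau_0\le\tau_1$, the events $(\tau_0,x_0)$ and $(\tau_0,x_1)$ are indistinguishable on $[\tau_0,\tau_1]$ if $x_0,x_1\in\mathbb{F}^n$ and for every input $u\colon[\tau_0,\tau_1)\to\mathbb{F}^r$ and every integer $t\in[\tau_0,\tau_1)$ we have $C(t)\varphi(t,\tau_0,x_0,u)=C(t)\varphi(t,\tau_0,x_1,u)$. The system is observable on $[t_0,t_1]$ if $x_0=x_1$ whenever $(t_0,x_0)$ and $(t_0,x_1)$ are indistinguishable on $[t_0,t_1]$. It is observable if indistinguishability of $(\tau_0,x_0)$ and $(\tau_0,x_1)$ on $[\tau_0,\tau_1]$ for all $\tau_0$ and all $\tau_1\ge\tau_0$ implies $x_0=x_1$. *)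

theory Defs
  imports
    "Jordan_Normal_Form.Schur_Decomposition"
    "Graph_Theory.Pair_Digraph"
begin

section \<open>The scalar field\<close>

text \<open>The axiom leaves exactly two possibilities up to isomorphism: the reals with trivial
  conjugation, and the complex numbers with complex conjugation.  Both types are instances, so a
  theorem about this class covers the real and the complex case.\<close>

class real_or_complex = real_field + conjugatable_field +
  assumes real_or_complex_cases:
    "(\<forall>x. (\<exists>a. x = scaleR a 1) \<and> conjugate x = x) \<or>
     (\<exists>i. i * i = - 1 \<and>
       (\<forall>x. \<exists>a b. x = scaleR a 1 + scaleR b i \<and> conjugate x = scaleR a 1 - scaleR b i))"

instance real :: real_or_complex
  by standard simp

instance complex :: real_or_complex
proof
  have "\<exists>a b. x = a *\<^sub>R 1 + b *\<^sub>R \<i> \<and> conjugate x = a *\<^sub>R 1 - b *\<^sub>R \<i>" for x :: complex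
    by (rule exI[of _ "Re x"], rule exI[of _ "Im x"]) (simp add: complex_eq_iff)
  then show "(\<forall>x::complex. (\<exists>a. x = a *\<^sub>R 1) \<and> conjugate x = x) \<or>
     (\<exists>i::complex. i * i = - 1 \<and>
       (\<forall>x. \<exists>a b. x = a *\<^sub>R 1 + b *\<^sub>R i \<and> conjugate x = a *\<^sub>R 1 - b *\<^sub>R i))"
    by (intro disjI2 exI[of _ "\<i>"]) auto
qed

section \<open>Nonzero patterns\<close>

definition pattern_rel :: "nat \<Rightarrow> nat \<Rightarrow> ('a::zero mat) rel" where
  "pattern_rel p q = {(X, Y). X \<in> carrier_mat p q \<and> Y \<in> carrier_mat p q \<and>
     (\<forall>i<p. \<forall>j<q. X $$ (i, j) = 0 \<longleftrightarrow> Y $$ (i, j) = 0)}"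

definition patterns :: "nat \<Rightarrow> nat \<Rightarrow> ('a::zero mat) set set" where
  "patterns p q = carrier_mat p q // pattern_rel p q"

definition pattern_of :: "'a::zero mat \<Rightarrow> 'a mat set" where
  "pattern_of X = pattern_rel (dim_row X) (dim_col X) `` {X}"

text \<open>Matrix entries are indexed from 0, as usual for the type of matrices.\<close>

definition star_entry :: "'a::zero mat set \<Rightarrow> nat \<Rightarrow> nat \<Rightarrow> bool" where
  "star_entry P i j \<longleftrightarrow> (\<exists>X\<in>P. X $$ (i, j) \<noteq> 0)"

text \<open>On the reals \<open>conjugate\<close> is the identity, so \<open>mat_adjoint\<close> is the plain transpose there.\<close>

definition pattern_adjoint :: "'a::conjugatable_field mat set \<Rightarrow> 'a mat set" where
  "pattern_adjoint P = (\<Union>X\<in>P. pattern_of (mat_adjoint X))"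

definition juxtapose :: "'a::zero mat \<Rightarrow> 'a mat \<Rightarrow> 'a mat" where
  "juxtapose X Y = mat (dim_row X) (dim_col X + dim_col Y)
     (\<lambda>(i, j). if j < dim_col X then X $$ (i, j) else Y $$ (i, j - dim_col X))"

definition pattern_juxtapose :: "'a::zero mat set \<Rightarrow> 'a mat set \<Rightarrow> 'a mat set" where
  "pattern_juxtapose P Q = (\<Union>X\<in>P. \<Union>Y\<in>Q. pattern_of (juxtapose X Y))"

lemma equiv_pattern_rel: "equiv (carrier_mat p q) (pattern_rel p q)"
  by (rule equivI) (auto simp: pattern_rel_def refl_on_def sym_def trans_def)

lemma pattern_of_in_patterns: "X \<in> carrier_mat p q \<Longrightarrow> pattern_of X \<in> patterns p q"
  unfolding pattern_of_def patterns_def by (auto intro: quotientI)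

lemma pattern_of_eq_iff:
  assumes "X \<in> carrier_mat p q" "Y \<in> carrier_mat p q"
  shows "pattern_of X = pattern_of Y \<longleftrightarrow> (X, Y) \<in> pattern_rel p q"
  using assms eq_equiv_class_iff[OF equiv_pattern_rel[of p q], of X Y]
  by (auto simp: pattern_of_def)

lemma patterns_pattern_of:
  assumes "P \<in> patterns p q" "X \<in> P"
  shows "X \<in> carrier_mat p q" "P = pattern_of X"
proof -
  obtain Y where Y: "Y \<in> carrier_mat p q" "P = pattern_rel p q `` {Y}"
    using assms(1) by (auto simp: patterns_def elim: quotientE)
  with assms(2) have XY: "(Y, X) \<in> pattern_rel p q" by auto
  then show X: "X \<in> carrier_mat p q" by (auto simp: pattern_rel_def)
  show "P = pattern_of X"
    using XY X Y equiv_class_eq[OF equiv_pattern_rel XY] by (auto simp: pattern_of_def)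
qed

lemma patterns_nonempty: "P \<in> patterns p q \<Longrightarrow> \<exists>X. X \<in> P"
  using in_quotient_imp_non_empty[OF equiv_pattern_rel] by (fastforce simp: patterns_def)

lemma star_entry_pattern_of:
  assumes "X \<in> carrier_mat p q" "i < p" "j < q"
  shows "star_entry (pattern_of X) i j \<longleftrightarrow> X $$ (i, j) \<noteq> 0"
  using assms unfolding star_entry_def pattern_of_def pattern_rel_def by auto

lemma juxtapose_carrier:
  "X \<in> carrier_mat p q \<Longrightarrow> Y \<in> carrier_mat p s \<Longrightarrow> juxtapose X Y \<in> carrier_mat p (q + s)"
  by (auto simp: juxtapose_def)

lemma pattern_juxtapose_pattern_of:
  fixes X Y :: "'a::zero mat"
  assumes X: "X \<in> carrier_mat p q" and Y: "Y \<in> carrier_mat p s"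
  shows "pattern_juxtapose (pattern_of X) (pattern_of Y) = pattern_of (juxtapose X Y)"
proof -
  have "pattern_of (juxtapose X' Y') = pattern_of (juxtapose X Y)"
    if "X' \<in> pattern_of X" "Y' \<in> pattern_of Y" for X' Y'
  proof -
    have "X' \<in> carrier_mat p q" "Y' \<in> carrier_mat p s"
      using that X Y by (auto simp: pattern_of_def pattern_rel_def)
    moreover have "(juxtapose X' Y', juxtapose X Y) \<in> pattern_rel p (q + s)"
      using that X Y by (auto simp: pattern_of_def pattern_rel_def juxtapose_def)
    ultimately show ?thesis
      using X Y by (subst pattern_of_eq_iff[of _ p "q + s"]) (auto intro: juxtapose_carrier)
  qed
  moreover have "X \<in> pattern_of X" "Y \<in> pattern_of Y"
    by (auto simp: pattern_of_def pattern_rel_def)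
  ultimately show ?thesis unfolding pattern_juxtapose_def by blast
qed

lemma mat_adjoint_carrier: "X \<in> carrier_mat p q \<Longrightarrow> mat_adjoint X \<in> carrier_mat q p"
  by (auto simp: mat_adjoint_def)

lemma mat_adjoint_index:
  "X \<in> carrier_mat p q \<Longrightarrow> i < q \<Longrightarrow> j < p \<Longrightarrow> mat_adjoint X $$ (i, j) = conjugate (X $$ (j, i))"
  by (auto simp: mat_adjoint_def mat_of_rows_def)

lemma pattern_adjoint_pattern_of:
  fixes X :: "'a::conjugatable_field mat"
  assumes X: "X \<in> carrier_mat p q"
  shows "pattern_adjoint (pattern_of X) = pattern_of (mat_adjoint X)"
proof -
  have "pattern_of (mat_adjoint X') = pattern_of (mat_adjoint X)" if "X' \<in> pattern_of X" for X'
  proof -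
    have X': "X' \<in> carrier_mat p q"
      using that X by (auto simp: pattern_of_def pattern_rel_def)
    have "(mat_adjoint X', mat_adjoint X) \<in> pattern_rel q p"
      using that X X'
      by (auto simp: pattern_of_def pattern_rel_def mat_adjoint_carrier mat_adjoint_index)
    then show ?thesis
      using X X' by (subst pattern_of_eq_iff[of _ q p]) (auto intro: mat_adjoint_carrier)
  qed
  moreover have "X \<in> pattern_of X" by (auto simp: pattern_of_def pattern_rel_def)
  ultimately show ?thesis unfolding pattern_adjoint_def by blast
qed

lemma pattern_adjoint_in_patterns:
  "P \<in> patterns p q \<Longrightarrow> pattern_adjoint P \<in> patterns q p"
  by (metis mat_adjoint_carrier pattern_adjoint_pattern_of pattern_of_in_patterns
      patterns_nonempty patterns_pattern_of)

section \<open>The graph of a pattern\<close>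

text \<open>Vertices are numbered from 1, hence the index shift.\<close>

definition pattern_graph :: "nat \<Rightarrow> nat \<Rightarrow> 'a::zero mat set \<Rightarrow> nat pair_pre_digraph" where
  "pattern_graph p q M = \<lparr>pverts = {1..q},
     parcs = {(v, w). v \<in> {1..q} \<and> w \<in> {1..p} \<and> star_entry M (w - 1) (v - 1)}\<rparr>"

definition Pre :: "'v pair_pre_digraph \<Rightarrow> 'v set \<Rightarrow> 'v set" where
  "Pre G V = (parcs G)\<inverse> `` V"

definition Post :: "'v pair_pre_digraph \<Rightarrow> 'v set \<Rightarrow> 'v set" where
  "Post G V = parcs G `` V"

section \<open>Discrete-time systems\<close>

definition dt_system :: "nat \<Rightarrow> nat \<Rightarrow> nat \<Rightarrow> (int \<Rightarrow> 'a mat) \<Rightarrow> (int \<Rightarrow> 'a mat) \<Rightarrow>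
    (int \<Rightarrow> 'a mat) \<Rightarrow> (int \<Rightarrow> 'a mat) \<Rightarrow> bool" where
  "dt_system n r m A B C D \<longleftrightarrow> (\<forall>t. A t \<in> carrier_mat n n \<and> B t \<in> carrier_mat n r \<and>
     C t \<in> carrier_mat m n \<and> D t \<in> carrier_mat m r)"

definition time_invariant :: "(int \<Rightarrow> 'a mat) \<Rightarrow> (int \<Rightarrow> 'a mat) \<Rightarrow>
    (int \<Rightarrow> 'a mat) \<Rightarrow> (int \<Rightarrow> 'a mat) \<Rightarrow> bool" where
  "time_invariant A B C D \<longleftrightarrow>
     (\<forall>s t. A s = A t \<and> B s = B t \<and> C s = C t \<and> D s = D t)"

definition of_output_pattern :: "'a mat set \<Rightarrow> 'a mat set \<Rightarrow>
    (int \<Rightarrow> 'a mat) \<Rightarrow> (int \<Rightarrow> 'a mat) \<Rightarrow> bool" where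
  "of_output_pattern \<A> \<C> A C \<longleftrightarrow> (\<forall>t. A t \<in> \<A> \<and> C t \<in> \<C>)"

primrec steps :: "(int \<Rightarrow> 'a::semiring_0 mat) \<Rightarrow> (int \<Rightarrow> 'a mat) \<Rightarrow> int \<Rightarrow> 'a vec \<Rightarrow>
    (int \<Rightarrow> 'a vec) \<Rightarrow> nat \<Rightarrow> 'a vec" where
  "steps A B t\<^sub>0 x\<^sub>0 u 0 = x\<^sub>0"
| "steps A B t\<^sub>0 x\<^sub>0 u (Suc k) =
     A (t\<^sub>0 + int k) *\<^sub>v steps A B t\<^sub>0 x\<^sub>0 u k + B (t\<^sub>0 + int k) *\<^sub>v u (t\<^sub>0 + int k)"

definition solution :: "(int \<Rightarrow> 'a::semiring_0 mat) \<Rightarrow> (int \<Rightarrow> 'a mat) \<Rightarrow> int \<Rightarrow> int \<Rightarrow> 'a vec \<Rightarrow>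
    (int \<Rightarrow> 'a vec) \<Rightarrow> 'a vec" where
  "solution A B t t\<^sub>0 x\<^sub>0 u = steps A B t\<^sub>0 x\<^sub>0 u (nat (t - t\<^sub>0))"

lemma solution_initial: "solution A B t\<^sub>0 t\<^sub>0 x\<^sub>0 u = x\<^sub>0"
  by (simp add: solution_def)

lemma solution_step:
  assumes "t\<^sub>0 \<le> t"
  shows "solution A B (t + 1) t\<^sub>0 x\<^sub>0 u = A t *\<^sub>v solution A B t t\<^sub>0 x\<^sub>0 u + B t *\<^sub>v u t"
proof -
  have "nat (t + 1 - t\<^sub>0) = Suc (nat (t - t\<^sub>0))" using assms by simp
  then show ?thesis using assms by (simp add: solution_def)
qed

lemma solution_unique:
  assumes "x t\<^sub>0 = x\<^sub>0" "\<And>t. t\<^sub>0 \<le> t \<Longrightarrow> x (t + 1) = A t *\<^sub>v x t + B t *\<^sub>v u t" "t\<^sub>0 \<le> t"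
  shows "x t = solution A B t t\<^sub>0 x\<^sub>0 u"
  using assms(3)
  by (induction t rule: int_ge_induct) (simp_all add: assms(1,2) solution_initial solution_step)

section \<open>Observability\<close>

text \<open>Inputs are total functions; their values outside \<open>{\<tau>\<^sub>0..<\<tau>\<^sub>1}\<close> are irrelevant.\<close>

definition indistinguishable :: "nat \<Rightarrow> nat \<Rightarrow> (int \<Rightarrow> 'a::semiring_0 mat) \<Rightarrow> (int \<Rightarrow> 'a mat) \<Rightarrow>
    (int \<Rightarrow> 'a mat) \<Rightarrow> int \<Rightarrow> int \<Rightarrow> 'a vec \<Rightarrow> 'a vec \<Rightarrow> bool" where
  "indistinguishable n r A B C \<tau>\<^sub>0 \<tau>\<^sub>1 x\<^sub>0 x\<^sub>1 \<longleftrightarrow>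
     x\<^sub>0 \<in> carrier_vec n \<and> x\<^sub>1 \<in> carrier_vec n \<and>
     (\<forall>u. (\<forall>s\<in>{\<tau>\<^sub>0..<\<tau>\<^sub>1}. u s \<in> carrier_vec r) \<longrightarrow>
        (\<forall>t\<in>{\<tau>\<^sub>0..<\<tau>\<^sub>1}.
           C t *\<^sub>v solution A B t \<tau>\<^sub>0 x\<^sub>0 u = C t *\<^sub>v solution A B t \<tau>\<^sub>0 x\<^sub>1 u))"

definition observable_on :: "nat \<Rightarrow> nat \<Rightarrow> (int \<Rightarrow> 'a::semiring_0 mat) \<Rightarrow> (int \<Rightarrow> 'a mat) \<Rightarrow>
    (int \<Rightarrow> 'a mat) \<Rightarrow> int \<Rightarrow> int \<Rightarrow> bool" where
  "observable_on n r A B C t\<^sub>0 t\<^sub>1 \<longleftrightarrow>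
     (\<forall>x\<^sub>0\<in>carrier_vec n. \<forall>x\<^sub>1\<in>carrier_vec n.
        indistinguishable n r A B C t\<^sub>0 t\<^sub>1 x\<^sub>0 x\<^sub>1 \<longrightarrow> x\<^sub>0 = x\<^sub>1)"

definition observable :: "nat \<Rightarrow> nat \<Rightarrow> (int \<Rightarrow> 'a::semiring_0 mat) \<Rightarrow> (int \<Rightarrow> 'a mat) \<Rightarrow>
    (int \<Rightarrow> 'a mat) \<Rightarrow> bool" where
  "observable n r A B C \<longleftrightarrow>
     (\<forall>x\<^sub>0\<in>carrier_vec n. \<forall>x\<^sub>1\<in>carrier_vec n.
        (\<forall>\<tau>\<^sub>0 \<tau>\<^sub>1. \<tau>\<^sub>0 \<le> \<tau>\<^sub>1 \<longrightarrow> indistinguishable n r A B C \<tau>\<^sub>0 \<tau>\<^sub>1 x\<^sub>0 x\<^sub>1) \<longrightarrow> x\<^sub>0 = x\<^sub>1)"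

section \<open>The block pattern\<close>

definition block :: "'a mat \<Rightarrow> nat \<Rightarrow> nat \<Rightarrow> nat \<Rightarrow> nat \<Rightarrow> 'a mat" where
  "block X h w i\<^sub>0 j\<^sub>0 = mat h w (\<lambda>(a, b). X $$ (i\<^sub>0 + a, j\<^sub>0 + b))"

text \<open>Block rows \<open>i\<close> and block columns \<open>j\<close> are numbered from 1; the second conjunct speaks about
  the block columns \<open>N + 1, \<dots>, 2 * N\<close>, which have width \<open>m\<close>.\<close>

definition block_pattern :: "nat \<Rightarrow> nat \<Rightarrow> nat \<Rightarrow> 'a::conjugatable_field mat set \<Rightarrow>
    'a mat set \<Rightarrow> 'a mat set" where
  "block_pattern n m N \<A> \<C> = {X \<in> carrier_mat (n * N) ((n + m) * N).
     (\<forall>i\<in>{1..N}. \<forall>j\<in>{1..N}.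
        block X n n ((i - 1) * n) ((j - 1) * n) \<in>
          (if j = i + 1 then pattern_of (1\<^sub>m n)
           else if j = i \<and> 2 \<le> i then pattern_adjoint \<A>
           else pattern_of (0\<^sub>m n n))) \<and>
     (\<forall>i\<in>{1..N}. \<forall>j\<in>{1..N}.
        block X n m ((i - 1) * n) (N * n + (j - 1) * m) \<in>
          (if j = i then pattern_adjoint \<C> else pattern_of (0\<^sub>m n m)))}"

lemma block_mem_pattern_of:
  assumes "Z \<in> carrier_mat h w"
  shows "block X h w i\<^sub>0 j\<^sub>0 \<in> pattern_of Z \<longleftrightarrow>
    (\<forall>a<h. \<forall>b<w. X $$ (i\<^sub>0 + a, j\<^sub>0 + b) = 0 \<longleftrightarrow> Z $$ (a, b) = 0)"
  using assms by (auto simp: pattern_of_def pattern_rel_def block_def)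

lemma block_index_less:
  fixes a h i N :: nat
  assumes "i \<in> {1..N}" "a < h"
  shows "(i - 1) * h + a < h * N"
proof -
  have "(i - 1) * h + a < (i - 1) * h + h" using assms by simp
  also have "\<dots> = h * i" using assms(1) by (cases i) auto
  also have "\<dots> \<le> h * N" using assms(1) by simp
  finally show ?thesis .
qed

lemma block_index_decomp:
  fixes k h N :: nat
  assumes "k < h * N"
  obtains i a where "i \<in> {1..N}" "a < h" "k = (i - 1) * h + a"
proof
  have "0 < h" using assms by (cases h) auto
  then show "k mod h < h" by simp
  show "k div h + 1 \<in> {1..N}"
    using assms by (simp add: less_mult_imp_div_less mult.commute Suc_leI)
  show "k = (k div h + 1 - 1) * h + k mod h" by simp
qed

lemma block_pattern_in_patterns:
  fixes \<A> \<C> :: "'a::conjugatable_field mat set"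
  assumes "\<A> \<in> patterns n n" "\<C> \<in> patterns m n"
  shows "block_pattern n m N \<A> \<C> \<in> patterns (n * N) ((n + m) * N)"
proof -
  obtain A C where AC: "A \<in> carrier_mat n n" "pattern_adjoint \<A> = pattern_of A"
    "C \<in> carrier_mat n m" "pattern_adjoint \<C> = pattern_of C"
    by (metis assms patterns_nonempty patterns_pattern_of pattern_adjoint_in_patterns)
  define L where "L i j = (if j = i + 1 then 1\<^sub>m n else if j = i \<and> 2 \<le> i then A else 0\<^sub>m n n)"
    for i j :: nat
  define R where "R i j = (if j = i then C else 0\<^sub>m n m)" for i j :: nat
  have LR [simp]: "L i j \<in> carrier_mat n n" "R i j \<in> carrier_mat n m" for i j
    using AC by (auto simp: L_def R_def)
  define K where "K = mat (n * N) ((n + m) * N) (\<lambda>(r, c).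
     if c < N * n then L (r div n + 1) (c div n + 1) $$ (r mod n, c mod n)
     else R (r div n + 1) ((c - N * n) div m + 1) $$ (r mod n, (c - N * n) mod m))"
  have K: "K \<in> carrier_mat (n * N) ((n + m) * N)" by (simp add: K_def)
  have KL: "K $$ ((i - 1) * n + a, (j - 1) * n + b) = L i j $$ (a, b)"
    if "i \<in> {1..N}" "j \<in> {1..N}" "a < n" "b < n" for i j a b
  proof -
    have "(j - 1) * n + b < N * n" "(j - 1) * n + b < (n + m) * N"
      using block_index_less[of j N b n] that by (simp_all add: algebra_simps)
    moreover have "((j - 1) * n + b) div n + 1 = j" "((j - 1) * n + b) mod n = b"
      "((i - 1) * n + a) div n + 1 = i" "((i - 1) * n + a) mod n = a"
      using that by auto
    ultimately show ?thesis
      using block_index_less[of i N a n] that by (simp add: K_def)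
  qed
  have KR: "K $$ ((i - 1) * n + a, N * n + ((j - 1) * m + b)) = R i j $$ (a, b)"
    if "i \<in> {1..N}" "j \<in> {1..N}" "a < n" "b < m" for i j a b
  proof -
    have "N * n + ((j - 1) * m + b) < (n + m) * N"
      using block_index_less[of j N b m] that by (simp add: algebra_simps)
    moreover have "((j - 1) * m + b) div m + 1 = j" "((j - 1) * m + b) mod m = b"
      "((i - 1) * n + a) div n + 1 = i" "((i - 1) * n + a) mod n = a"
      using that by auto
    ultimately show ?thesis
      using block_index_less[of i N a n] that by (simp add: K_def)
  qed
  have mem: "X \<in> block_pattern n m N \<A> \<C> \<longleftrightarrow> X \<in> carrier_mat (n * N) ((n + m) * N) \<and>
     (\<forall>i\<in>{1..N}. \<forall>j\<in>{1..N}. \<forall>a<n. \<forall>b<n.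
        X $$ ((i - 1) * n + a, (j - 1) * n + b) = 0 \<longleftrightarrow> L i j $$ (a, b) = 0) \<and>
     (\<forall>i\<in>{1..N}. \<forall>j\<in>{1..N}. \<forall>a<n. \<forall>b<m.
        X $$ ((i - 1) * n + a, N * n + ((j - 1) * m + b)) = 0 \<longleftrightarrow> R i j $$ (a, b) = 0)" for X
  proof -
    have "(if j = i + 1 then pattern_of (1\<^sub>m n) else if j = i \<and> 2 \<le> i then pattern_adjoint \<A>
        else pattern_of (0\<^sub>m n n)) = pattern_of (L i j)"
      "(if j = i then pattern_adjoint \<C> else pattern_of (0\<^sub>m n m)) = pattern_of (R i j)"
      for i j :: nat
      using AC by (auto simp: L_def R_def)
    then show ?thesis
      unfolding block_pattern_def by (simp add: block_mem_pattern_of[OF LR(1)]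
        block_mem_pattern_of[OF LR(2)] add.assoc del: One_nat_def)
  qed
  have "block_pattern n m N \<A> \<C> = pattern_of K"
  proof (intro equalityI subsetI)
    fix X assume "X \<in> block_pattern n m N \<A> \<C>"
    note X = this[unfolded mem]
    have "K $$ (r, c) = 0 \<longleftrightarrow> X $$ (r, c) = 0" if r: "r < n * N" and c: "c < (n + m) * N" for r c
    proof -
      obtain i a where i: "i \<in> {1..N}" "a < n" "r = (i - 1) * n + a"
        using block_index_decomp[OF r] .
      show ?thesis
      proof (cases "c < n * N")
        case True
        then obtain j b where "j \<in> {1..N}" "b < n" "c = (j - 1) * n + b"
          using block_index_decomp by blast
        then show ?thesis using i X KL by simp
      next
        case False
        then have "c - N * n < m * N" using c by (simp add: algebra_simps)
        then obtain j b where j: "j \<in> {1..N}" "b < m" "c - N * n = (j - 1) * m + b"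
          using block_index_decomp by blast
        then have "c = N * n + ((j - 1) * m + b)" using False by (simp add: algebra_simps)
        then show ?thesis using i j(1,2) X KR by simp
      qed
    qed
    then show "X \<in> pattern_of K" using K X by (auto simp: pattern_of_def pattern_rel_def)
  next
    fix X assume "X \<in> pattern_of K"
    then have X: "X \<in> carrier_mat (n * N) ((n + m) * N)"
      and eq: "\<And>r c. r < n * N \<Longrightarrow> c < (n + m) * N \<Longrightarrow> K $$ (r, c) = 0 \<longleftrightarrow> X $$ (r, c) = 0"
      using K by (auto simp: pattern_of_def pattern_rel_def)
    have "X $$ ((i - 1) * n + a, (j - 1) * n + b) = 0 \<longleftrightarrow> L i j $$ (a, b) = 0"
      if "i \<in> {1..N}" "j \<in> {1..N}" "a < n" "b < n" for i j a b
      using eq[of "(i - 1) * n + a" "(j - 1) * n + b"] KL[OF that] that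
        block_index_less[of i N a n] block_index_less[of j N b n]
      by (simp add: algebra_simps)
    moreover have "X $$ ((i - 1) * n + a, N * n + ((j - 1) * m + b)) = 0 \<longleftrightarrow> R i j $$ (a, b) = 0"
      if "i \<in> {1..N}" "j \<in> {1..N}" "a < n" "b < m" for i j a b
    proof -
      have "N * n + ((j - 1) * m + b) < (n + m) * N"
        using block_index_less[of j N b m] that by (simp add: algebra_simps)
      then show ?thesis
        using eq[of "(i - 1) * n + a" "N * n + ((j - 1) * m + b)"] KR[OF that] that
          block_index_less[of i N a n] by simp
    qed
    ultimately show "X \<in> block_pattern n m N \<A> \<C>" using X unfolding mem by blast
  qed
  then show ?thesis using pattern_of_in_patterns[OF K] by simp
qed

section \<open>The graph condition\<close>

definition condition_G3 :: "nat \<Rightarrow> nat \<Rightarrow> nat pair_pre_digraph \<Rightarrow> bool" where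
  "condition_G3 p q G \<longleftrightarrow> (\<forall>V\<subseteq>{1..p}. V \<noteq> {} \<longrightarrow>
     (\<exists>v\<in>{1..q}. \<exists>!w. w \<in> V \<and> (v, w) \<in> parcs G))"

end

theory Submission
  imports Defs
begin

text \<open>
  A system fails to be observable on \<open>[t\<^sub>0, t\<^sub>1]\<close> exactly when some nonzero run of
  \<open>x(t + 1) = A(t) x(t)\<close> has zero output throughout. What a pattern sees of such a run is only
  the sequence of supports \<open>V k = {a. x(t\<^sub>0 + k)\<^sub>a \<noteq> 0}\<close>. A sum of products along a row cannot vanish
  if exactly one of its summands is nonzero, and it is zero if none is. Hence a row of \<open>\<C>\<close> never
  meets \<open>V k\<close> in exactly one star, a row of \<open>\<A>\<close> that does so has its index in \<open>V (k + 1)\<close>, and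
  every index in \<open>V (k + 1)\<close> belongs to a row of \<open>\<A>\<close> that meets \<open>V k\<close>. These are the
  \<^emph>\<open>silent\<close> sequences (\<open>silent_supports\<close>). Conversely, the entries of a row
  are free apart from being nonzero, one nonzero number can take any nonzero value, and two or
  more of them can have any prescribed sum. So every silent sequence is realized, by the
  indicator vectors of its members, with suitable matrices of the two patterns
  (\<open>pattern_realization\<close>, \<open>all_observable_on_iff\<close>).

  The graph of \<open>\<K>\<close> only encodes silent sequences: its first \<open>n N\<close> vertices are pairs of a time and
  a state index, and a column of \<open>\<K>\<close> lists the entries that occur in one scalar equation of the
  run. A nonempty set \<open>V\<close> in which no vertex has exactly one successor is the same as a silent
  sequence that is not empty throughout (\<open>condition_G3_iff\<close>).

  For time-invariant systems, the relevant sequences are generated by a single set \<open>U\<close>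
  that no row of \<open>\<C>\<close> meets in exactly one star. The indicator vector of \<open>U\<close> can be made an
  unobserved eigenvector for the eigenvalue 0 if no row of \<open>\<A>\<close> meets \<open>U\<close> in exactly one
  star, which is how (a) fails, and for the eigenvalue 1 if the rows with index outside \<open>U\<close>
  have this property and the rows with index in \<open>U\<close> all meet \<open>U\<close>, which is how (b) fails. Such sets are the \<^emph>\<open>invariant supports\<close>, and they give time-invariant systems that
  are not observable (\<open>invariant_support_unobservable\<close>).

  The remaining point is that (a) and (b) exclude silent sequences of length \<open>N \<ge> n\<close>; it is purely
  combinatorial (\<open>silent_supports_invariant\<close>). If the sequence dies out, its last nonempty member
  violates (a). Otherwise, look for a window \<open>V i, \<dots>, V j\<close> in which no element occurs only at the
  first or only at the last time: then \<open>V i \<union> \<dots> \<union> V (j - 1) = V (i + 1) \<union> \<dots> \<union> V j\<close>, and this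
  union violates (b). Without such a window, cutting off endpoints shows that the union \<open>R\<close> of all
  members has at least \<open>N\<close> elements, so \<open>R\<close> consists of all \<open>n\<close> indices. Then \<open>R\<close> itself violates
  (b), unless \<open>\<A>\<close> has a zero row \<open>u\<close>. In that case, \<open>u\<close> can occur in \<open>V 0\<close> only. Either
  \<open>N = 1\<close>, and \<open>R = {u}\<close> violates (a), or induction applies to the sequence without \<open>V 0\<close> on the
  index set without \<open>u\<close>.
\<close>

section \<open>Supports of silent runs\<close>

definition isolates :: "(nat \<Rightarrow> nat \<Rightarrow> bool) \<Rightarrow> nat \<Rightarrow> nat set \<Rightarrow> bool" where
  "isolates R b U \<longleftrightarrow> (\<exists>!a. a \<in> U \<and> R b a)"

text \<open>The relation \<open>\<alpha> b a\<close> says that row \<open>b\<close> of the state pattern has a star at \<open>a\<close>; likewise \<open>\<gamma>\<close> for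
  the output pattern. The conditions are those that the supports of an unobserved run of length \<open>N\<close>
  satisfy for every choice of matrices; the bound \<open>Suc k < N\<close> is there because only \<open>N\<close> states
  are output.\<close>
definition silent_supports :: "(nat \<Rightarrow> nat \<Rightarrow> bool) \<Rightarrow> (nat \<Rightarrow> nat \<Rightarrow> bool) \<Rightarrow> nat \<Rightarrow> nat \<Rightarrow> nat \<Rightarrow>
    (nat \<Rightarrow> nat set) \<Rightarrow> bool" where
  "silent_supports \<alpha> \<gamma> n m N V \<longleftrightarrow>
     (\<forall>k<N. V k \<subseteq> {..<n} \<and> (\<forall>c<m. \<not> isolates \<gamma> c (V k))) \<and>
     (\<forall>k. Suc k < N \<longrightarrow> (\<forall>b<n. isolates \<alpha> b (V k) \<longrightarrow> b \<in> V (Suc k)) \<and>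
        (\<forall>b\<in>V (Suc k). \<exists>a\<in>V k. \<alpha> b a))"

text \<open>The two alternatives correspond to an unobserved eigenvector with support \<open>U\<close> for the
  eigenvalue 0 and for a nonzero eigenvalue.\<close>
definition invariant_support :: "(nat \<Rightarrow> nat \<Rightarrow> bool) \<Rightarrow> (nat \<Rightarrow> nat \<Rightarrow> bool) \<Rightarrow> nat \<Rightarrow> nat \<Rightarrow>
    nat set \<Rightarrow> bool" where
  "invariant_support \<alpha> \<gamma> n m U \<longleftrightarrow> U \<subseteq> {..<n} \<and> U \<noteq> {} \<and> (\<forall>c<m. \<not> isolates \<gamma> c U) \<and>
     ((\<forall>b<n. \<not> isolates \<alpha> b U) \<or>
      (\<forall>b\<in>U. \<exists>a\<in>U. \<alpha> b a) \<and> (\<forall>b<n. b \<notin> U \<longrightarrow> \<not> isolates \<alpha> b U))"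

lemma silent_supportsD:
  assumes "silent_supports \<alpha> \<gamma> n m N V"
  shows silent_supports_subset: "k < N \<Longrightarrow> V k \<subseteq> {..<n}"
    and silent_supports_output: "k < N \<Longrightarrow> c < m \<Longrightarrow> \<not> isolates \<gamma> c (V k)"
    and silent_supports_step: "Suc k < N \<Longrightarrow> b < n \<Longrightarrow> isolates \<alpha> b (V k) \<Longrightarrow> b \<in> V (Suc k)"
    and silent_supports_pred: "Suc k < N \<Longrightarrow> b \<in> V (Suc k) \<Longrightarrow> \<exists>a\<in>V k. \<alpha> b a"
  using assms by (simp_all add: silent_supports_def)

lemma isolates_Union:
  assumes "isolates R b (\<Union>k\<in>K. V k)"
  obtains k where "k \<in> K" "isolates R b (V k)"
  using assms unfolding isolates_def by blast

text \<open>If every window has an element that occurs in it only at one end, and only there, then cutting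
  off that end loses at least one element of the union. A sequence of length \<open>q - p + 1\<close> can be
  shortened \<open>q - p\<close> times, and what is left is still nonempty.\<close>
lemma card_Union_ge_length:
  fixes V :: "nat \<Rightarrow> 'b set"
  assumes "p \<le> q"
    and "\<And>k. k \<in> {p..q} \<Longrightarrow> finite (V k) \<and> V k \<noteq> {}"
    and "\<And>i j. \<lbrakk>p \<le> i; i < j; j \<le> q\<rbrakk> \<Longrightarrow>
      \<not> (V i \<subseteq> (\<Union>k\<in>{Suc i..j}. V k) \<and> V j \<subseteq> (\<Union>k\<in>{i..<j}. V k))"
  shows "Suc (q - p) \<le> card (\<Union>k\<in>{p..q}. V k)"
  using assms
proof (induction "q - p" arbitrary: p q)
  case 0
  then have "p = q" by simp
  then show ?case using 0 by (simp add: Suc_le_eq card_gt_0_iff)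
next
  case (Suc d)
  have pq: "p < q" using Suc.hyps(2) by simp
  have fin: "finite (\<Union>k\<in>{p..q}. V k)" using Suc.prems(2) by blast
  have extend: "Suc (q - p) \<le> card (\<Union>k\<in>{p..q}. V k)"
    if K: "K \<subseteq> {p..q}" and e: "e \<in> (\<Union>k\<in>{p..q}. V k)" "e \<notin> (\<Union>k\<in>K. V k)"
      and IH: "q - p \<le> card (\<Union>k\<in>K. V k)" for e K
  proof -
    have sub: "insert e (\<Union>k\<in>K. V k) \<subseteq> (\<Union>k\<in>{p..q}. V k)" using K e by blast
    have "finite (\<Union>k\<in>K. V k)" using sub fin by (meson finite_subset insert_subset)
    then have "Suc (q - p) \<le> card (insert e (\<Union>k\<in>K. V k))" using e(2) IH by simp
    also have "\<dots> \<le> card (\<Union>k\<in>{p..q}. V k)" using card_mono[OF fin sub] .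
    finally show ?thesis .
  qed
  consider e where "e \<in> V p" "e \<notin> (\<Union>k\<in>{Suc p..q}. V k)"
    | e where "e \<in> V q" "e \<notin> (\<Union>k\<in>{p..<q}. V k)"
    using Suc.prems(3)[of p q] pq by blast
  then show ?case
  proof cases
    case 1
    have "Suc (q - Suc p) \<le> card (\<Union>k\<in>{Suc p..q}. V k)"
      using Suc.hyps(2) pq Suc.prems by (intro Suc.hyps(1)) auto
    then show ?thesis using 1 pq by (intro extend[of "{Suc p..q}" e]) auto
  next
    case 2
    have "{p..<q} = {p..q - 1}" using pq by auto
    moreover have "Suc (q - 1 - p) \<le> card (\<Union>k\<in>{p..q - 1}. V k)"
      using Suc.hyps(2) pq Suc.prems by (intro Suc.hyps(1)) auto
    ultimately show ?thesis using 2 pq by (intro extend[of "{p..<q}" e]) auto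
  qed
qed

text \<open>The two inclusions make the union over \<open>{i..<j}\<close> equal to the union over \<open>{Suc i..j}\<close>. One
  step of the silent sequence leads from the former to the latter, so the union reproduces
  itself.\<close>
lemma recurrent_window_invariant:
  assumes V: "silent_supports \<alpha> \<gamma> n m N V" and ij: "i < j" "j < N" and ne: "V i \<noteq> {}"
    and first: "V i \<subseteq> (\<Union>k\<in>{Suc i..j}. V k)" and last: "V j \<subseteq> (\<Union>k\<in>{i..<j}. V k)"
  shows "invariant_support \<alpha> \<gamma> n m (\<Union>k\<in>{i..<j}. V k)"
proof -
  define U where "U = (\<Union>k\<in>{i..<j}. V k)"
  have "{i..j} = insert j {i..<j}" "{i..j} = insert i {Suc i..j}" using ij by auto
  then have U: "U = (\<Union>k\<in>{i..j}. V k)" "U = (\<Union>k\<in>{Suc i..j}. V k)"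
    using first last by (auto simp: U_def)
  have "\<exists>a\<in>U. \<alpha> b a" if "b \<in> U" for b
  proof -
    obtain k where k: "k \<in> {Suc i..j}" "b \<in> V k" using \<open>b \<in> U\<close> U(2) by blast
    then obtain l where "k = Suc l" by (cases k) auto
    with k ij obtain a where "a \<in> V l" "\<alpha> b a"
      using silent_supports_pred[OF V, of l b] by auto
    moreover have "l \<in> {i..<j}" using k \<open>k = Suc l\<close> by auto
    ultimately show ?thesis by (auto simp: U_def)
  qed
  moreover have "b \<in> U" if b: "b < n" "isolates \<alpha> b U" for b
  proof -
    obtain k where k: "k \<in> {i..<j}" "isolates \<alpha> b (V k)"
      using b(2) unfolding U_def by (rule isolates_Union)
    then have "b \<in> V (Suc k)" using V ij b(1) by (auto simp: silent_supports_def)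
    then show ?thesis using k(1) U(2) by auto
  qed
  moreover have "\<not> isolates \<gamma> c U" if "c < m" for c
    using V ij that unfolding U_def silent_supports_def
    by (meson atLeastLessThan_iff isolates_Union less_trans)
  moreover have "U \<subseteq> {..<n}"
    using silent_supports_subset[OF V] ij unfolding U_def by (intro UN_least) auto
  moreover have "U \<noteq> {}" using ne ij by (auto simp: U_def)
  ultimately show ?thesis unfolding U_def[symmetric] invariant_support_def by blast
qed

text \<open>The set \<open>R\<close> stands for the indices that are still in play: rows outside \<open>R\<close> have no star in
  \<open>R\<close>, so a subset of \<open>R\<close> is an invariant support of the whole pattern as soon as it is one of the
  pattern restricted to \<open>R\<close>. This makes the induction, which removes one index and one time
  together, possible.\<close>
lemma long_supports_invariant:
  assumes "silent_supports \<alpha> \<gamma> n m N V" and "\<And>k. k < N \<Longrightarrow> V k \<noteq> {} \<and> V k \<subseteq> R"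
    and "R \<subseteq> {..<n}" and "card R \<le> N" and "0 < N"
    and "\<And>a b. \<lbrakk>b < n; b \<notin> R; a \<in> R\<rbrakk> \<Longrightarrow> \<not> \<alpha> b a"
  shows "\<exists>U. invariant_support \<alpha> \<gamma> n m U"
  using assms
proof (induction N arbitrary: V R)
  case 0
  then show ?case by simp
next
  case (Suc N)
  note V = Suc.prems(1) and ne = Suc.prems(2) and R = Suc.prems(3) and blind = Suc.prems(6)
  have fin: "finite R" using R by (rule finite_subset) simp
  show ?case
  proof (cases "\<exists>i j. i < j \<and> j < Suc N \<and>
      V i \<subseteq> (\<Union>k\<in>{Suc i..j}. V k) \<and> V j \<subseteq> (\<Union>k\<in>{i..<j}. V k)")
    case True
    then obtain i j where ij: "i < j" "j < Suc N"
      "V i \<subseteq> (\<Union>k\<in>{Suc i..j}. V k)" "V j \<subseteq> (\<Union>k\<in>{i..<j}. V k)" by blast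
    moreover have "V i \<noteq> {}" using ne[of i] ij by simp
    ultimately show ?thesis using recurrent_window_invariant[OF V] by blast
  next
    case False
    have "Suc (N - 0) \<le> card (\<Union>k\<in>{0..N}. V k)"
    proof (rule card_Union_ge_length)
      show "finite (V k) \<and> V k \<noteq> {}" if "k \<in> {0..N}" for k
        using ne[of k] that finite_subset[OF _ fin] by auto
    qed (use False in auto)
    moreover have sub: "(\<Union>k\<in>{0..N}. V k) \<subseteq> R" using ne by (intro UN_least) auto
    ultimately have R_eq: "R = (\<Union>k\<in>{0..N}. V k)"
      using Suc.prems(4) card_seteq[OF fin sub] by simp
    have C: "\<not> isolates \<gamma> c R" if "c < m" for c
      using V that unfolding R_eq silent_supports_def
      by (meson atLeastAtMost_iff isolates_Union le_imp_less_Suc)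
    have out: "\<not> isolates \<alpha> b R" if "b < n" "b \<notin> R" for b
      using blind that by (auto simp: isolates_def)
    have R_ne: "R \<noteq> {}" using ne[of 0] by auto
    show ?thesis
    proof (cases "\<forall>b\<in>R. \<exists>a\<in>R. \<alpha> b a")
      case True
      then have "invariant_support \<alpha> \<gamma> n m R"
        using R R_ne C out by (simp add: invariant_support_def)
      then show ?thesis ..
    next
      case False
      \<comment> \<open>Row \<open>u\<close> meets no \<open>V k\<close>, because these are subsets of \<open>R\<close>. Hence \<open>u\<close> lies in no
        \<open>V (k + 1)\<close>.\<close>
      then obtain u where u: "u \<in> R" "\<And>a. a \<in> R \<Longrightarrow> \<not> \<alpha> u a" by blast
      show ?thesis
      proof (cases "N = 0")
        case True
        then have "card R = 1" using Suc.prems(4) R_ne fin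
          by (metis One_nat_def card_0_eq le_SucE le_zero_eq)
        then have "R = {u}" using u(1) by (auto simp: card_1_singleton_iff)
        then have "invariant_support \<alpha> \<gamma> n m R"
          using R C out u by (auto simp: invariant_support_def isolates_def)
        then show ?thesis ..
      next
        case False
        show ?thesis
        proof (rule Suc.IH)
          show "silent_supports \<alpha> \<gamma> n m N (\<lambda>k. V (Suc k))"
            using V by (simp add: silent_supports_def)
          show "V (Suc k) \<noteq> {} \<and> V (Suc k) \<subseteq> R - {u}" if "k < N" for k
          proof -
            have "u \<notin> V (Suc k)"
              using silent_supports_pred[OF V, of k u] that u(2) ne[of k] by auto
            then show ?thesis using ne[of "Suc k"] that by auto
          qed
          show "card (R - {u}) \<le> N" using Suc.prems(4) u(1) by simp
          show "\<not> \<alpha> b a" if "b < n" "b \<notin> R - {u}" "a \<in> R - {u}" for a b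
            using that blind u(2) by auto
        qed (use R False in auto)
      qed
    qed
  qed
qed

lemma silent_supports_initial:
  assumes "silent_supports \<alpha> \<gamma> n m N V" and "V 0 = {}"
  shows "k < N \<Longrightarrow> V k = {}"
  using assms by (induction k) (auto simp: silent_supports_def)

text \<open>A sequence that dies out passes from a nonempty \<open>V i\<close> to the empty set, which means that no
  row of the state pattern meets \<open>V i\<close> in exactly one star: the first alternative for
  \<open>V i\<close>.\<close>
lemma silent_supports_invariant:
  assumes V: "silent_supports \<alpha> \<gamma> n m N V" and k: "k < N" "V k \<noteq> {}" and "n \<le> N"
  shows "\<exists>U. invariant_support \<alpha> \<gamma> n m U"
proof (cases "\<exists>l<N. V l = {}")
  case False
  have "0 < N" using k by simp
  have "V l \<noteq> {} \<and> V l \<subseteq> {..<n}" if "l < N" for l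
    using V False that by (auto simp: silent_supports_def)
  then show ?thesis
    using long_supports_invariant[OF V, of "{..<n}"] \<open>n \<le> N\<close> \<open>0 < N\<close> by auto
next
  case True
  define l where "l = (LEAST l. V l = {})"
  obtain l' where l': "l' < N" "V l' = {}" using True by blast
  have l: "V l = {}" "l \<le> l'" using LeastI[of "\<lambda>l. V l = {}", OF l'(2)]
      Least_le[of "\<lambda>l. V l = {}", OF l'(2)] by (auto simp: l_def)
  have "V 0 \<noteq> {}" using silent_supports_initial[OF V] k by blast
  then obtain i where i: "l = Suc i" using l by (cases l) auto
  have "V i \<noteq> {}" using not_less_Least[of i "\<lambda>l. V l = {}"] i by (auto simp: l_def)
  moreover have "\<not> isolates \<alpha> b (V i)" if "b < n" for b
    using silent_supports_step[OF V, of i b] l l' i that by auto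
  ultimately have "invariant_support \<alpha> \<gamma> n m (V i)"
    using silent_supports_subset[OF V, of i] silent_supports_output[OF V, of i] l l' i
    by (simp add: invariant_support_def)
  then show ?thesis ..
qed

section \<open>Matrices of a pattern acting on supports\<close>

lemma mem_pattern_iff:
  assumes "P \<in> patterns p q"
  shows "X \<in> P \<longleftrightarrow> X \<in> carrier_mat p q \<and>
    (\<forall>i<p. \<forall>j<q. X $$ (i, j) \<noteq> 0 \<longleftrightarrow> star_entry P i j)"
proof -
  obtain Y where Y: "Y \<in> carrier_mat p q" "P = pattern_of Y"
    using assms patterns_nonempty patterns_pattern_of by blast
  have "star_entry P i j \<longleftrightarrow> Y $$ (i, j) \<noteq> 0" if "i < p" "j < q" for i j
    using star_entry_pattern_of[OF Y(1) that] Y(2) by simp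
  moreover have "X \<in> P \<longleftrightarrow> X \<in> carrier_mat p q \<and>
      (\<forall>i<p. \<forall>j<q. Y $$ (i, j) = 0 \<longleftrightarrow> X $$ (i, j) = 0)"
    using Y by (auto simp: pattern_of_def pattern_rel_def)
  ultimately show ?thesis by auto
qed

definition vec_support :: "'a::zero vec \<Rightarrow> nat set" where
  "vec_support x = {a. a < dim_vec x \<and> x $ a \<noteq> 0}"

definition indicator_vec :: "nat \<Rightarrow> nat set \<Rightarrow> 'a::zero_neq_one vec" where
  "indicator_vec n U = vec n (\<lambda>a. if a \<in> U then 1 else 0)"

lemma indicator_vec_carrier [simp]: "indicator_vec n U \<in> carrier_vec n"
  by (simp add: indicator_vec_def)

lemma indicator_vec_nonzero: "U \<subseteq> {..<n} \<Longrightarrow> U \<noteq> {} \<Longrightarrow> indicator_vec n U \<noteq> 0\<^sub>v n"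
  by (force simp: indicator_vec_def vec_eq_iff)

lemma pattern_mult_index:
  fixes X :: "'a::real_or_complex mat"
  assumes P: "P \<in> patterns p n" and X: "X \<in> P" and x: "x \<in> carrier_vec n" and i: "i < p"
  shows "(X *\<^sub>v x) $ i = (\<Sum>a | a \<in> vec_support x \<and> star_entry P i a. X $$ (i, a) * x $ a)"
proof -
  have c: "X \<in> carrier_mat p n" using mem_pattern_iff[OF P] X by blast
  then have "(X *\<^sub>v x) $ i = (\<Sum>a\<in>{0..<n}. X $$ (i, a) * x $ a)"
    using i x by (simp add: scalar_prod_def)
  also have "\<dots> = (\<Sum>a | a \<in> vec_support x \<and> star_entry P i a. X $$ (i, a) * x $ a)"
  proof (rule sum.mono_neutral_right)
    show "\<forall>a\<in>{0..<n} - {a. a \<in> vec_support x \<and> star_entry P i a}. X $$ (i, a) * x $ a = 0"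
      using X x i mem_pattern_iff[OF P, of X] by (auto simp: vec_support_def)
  qed (use x in \<open>auto simp: vec_support_def\<close>)
  finally show ?thesis .
qed

lemma pattern_mult_isolated:
  fixes X :: "'a::real_or_complex mat"
  assumes P: "P \<in> patterns p n" and X: "X \<in> P" and x: "x \<in> carrier_vec n" and i: "i < p"
    and "isolates (star_entry P) i (vec_support x)"
  shows "(X *\<^sub>v x) $ i \<noteq> 0"
proof -
  obtain e where e: "{a. a \<in> vec_support x \<and> star_entry P i a} = {e}"
    using assms(5) unfolding isolates_def by blast
  then have "e \<in> vec_support x" "star_entry P i e" by auto
  then have "X $$ (i, e) \<noteq> 0" "x $ e \<noteq> 0"
    using mem_pattern_iff[OF P, of X] X x i by (auto simp: vec_support_def)
  then show ?thesis using pattern_mult_index[OF P X x i] e by simp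
qed

lemma pattern_mult_nonzero:
  fixes X :: "'a::real_or_complex mat"
  assumes P: "P \<in> patterns p n" and X: "X \<in> P" and x: "x \<in> carrier_vec n" and i: "i < p"
    and "(X *\<^sub>v x) $ i \<noteq> 0"
  shows "\<exists>a\<in>vec_support x. star_entry P i a"
proof (rule ccontr)
  assume "\<not> ?thesis"
  then have none: "{a. a \<in> vec_support x \<and> star_entry P i a} = {}" by auto
  show False using assms(5) unfolding pattern_mult_index[OF P X x i] none by simp
qed

text \<open>Give all summands but one the same value \<open>d\<close>; the last one is then determined. It is nonzero
  for \<open>d = 1\<close> or for \<open>d = 2\<close>, except when it is the only summand and \<open>s = 0\<close>.\<close>
lemma nonzero_summands:
  fixes s :: "'a::real_or_complex"
  assumes fin: "finite S" and "s \<noteq> 0 \<Longrightarrow> S \<noteq> {}" and "s = 0 \<Longrightarrow> card S \<noteq> 1"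
  obtains f where "\<And>a. a \<in> S \<Longrightarrow> f a \<noteq> 0" "sum f S = s"
proof (cases "S = {}")
  case True
  then show ?thesis using assms that[of "\<lambda>_. 1"] by auto
next
  case False
  then obtain e where e: "e \<in> S" by blast
  define c :: 'a where "c = of_nat (card (S - {e}))"
  define d :: 'a where "d = (if s = c then 2 else 1)"
  have d: "d \<noteq> 0" by (simp add: d_def)
  have "s - c * d \<noteq> 0"
  proof (cases "c = 0")
    case True
    then have "S - {e} = {}" using fin by (simp add: c_def)
    then have "S = {e}" using e by blast
    then show ?thesis using True assms(3) by auto
  next
    case False
    then show ?thesis by (auto simp: d_def)
  qed
  moreover have "sum (\<lambda>a. if a = e then s - c * d else d) S = s"
    using e fin by (simp add: sum.remove[of S e] c_def)
  ultimately show ?thesis using d that[of "\<lambda>a. if a = e then s - c * d else d"] by simp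
qed

text \<open>The converse of \<open>pattern_mult_isolated\<close> and \<open>pattern_mult_nonzero\<close>: the two necessary conditions
  on the support of an image are also sufficient. The rows can be chosen independently of each
  other.\<close>
lemma pattern_realization:
  fixes P :: "'a::real_or_complex mat set"
  assumes P: "P \<in> patterns p n" and U: "U \<subseteq> {..<n}" and T: "T \<subseteq> {..<p}"
    and hit: "\<And>i. i \<in> T \<Longrightarrow> \<exists>a\<in>U. star_entry P i a"
    and iso: "\<And>i. i < p \<Longrightarrow> isolates (star_entry P) i U \<Longrightarrow> i \<in> T"
  obtains X where "X \<in> P" "X *\<^sub>v indicator_vec n U = indicator_vec p T"
proof -
  define s :: "nat \<Rightarrow> 'a" where "s i = (if i \<in> T then 1 else 0)" for i
  define S where "S i = {a. a \<in> U \<and> star_entry P i a}" for i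
  have fin: "finite (S i)" for i
    using U by (auto simp: S_def intro: finite_subset[of _ "{..<n}"])
  have "\<exists>f. (\<forall>a\<in>S i. f a \<noteq> 0) \<and> sum f (S i) = s i" if "i < p" for i
  proof -
    have "S i \<noteq> {}" if "s i \<noteq> 0" using that hit by (auto simp: s_def S_def split: if_splits)
    moreover have "card (S i) \<noteq> 1" if "s i = 0"
    proof
      assume "card (S i) = 1"
      then obtain e where "S i = {e}" by (auto simp: card_1_singleton_iff)
      then have "a \<in> U \<and> star_entry P i a \<longleftrightarrow> a = e" for a unfolding S_def by blast
      then have "isolates (star_entry P) i U" by (simp add: isolates_def)
      then show False using iso[OF \<open>i < p\<close>] that by (simp add: s_def)
    qed
    ultimately show ?thesis using nonzero_summands[OF fin[of i], of "s i"] by metis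
  qed
  then obtain f where f: "\<And>i a. i < p \<Longrightarrow> a \<in> S i \<Longrightarrow> f i a \<noteq> 0"
    "\<And>i. i < p \<Longrightarrow> sum (f i) (S i) = s i" by metis
  define X where "X = mat p n (\<lambda>(i, a). if a \<in> S i then f i a else if star_entry P i a then 1 else 0)"
  have "X \<in> P" unfolding mem_pattern_iff[OF P] using f(1) by (auto simp: X_def S_def)
  have support_U: "vec_support (indicator_vec n U :: 'a vec) = U"
    using U by (auto simp: vec_support_def indicator_vec_def split: if_splits)
  have "(X *\<^sub>v indicator_vec n U) $ i = s i" if "i < p" for i
  proof -
    have "(X *\<^sub>v indicator_vec n U) $ i = (\<Sum>a\<in>S i. X $$ (i, a) * indicator_vec n U $ a)"
      using pattern_mult_index[OF P \<open>X \<in> P\<close> _ that, of "indicator_vec n U"] by (simp add: support_U S_def)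
    also have "\<dots> = sum (f i) (S i)"
      using U that by (intro sum.cong) (auto simp: X_def indicator_vec_def S_def)
    finally show ?thesis using f(2) that by simp
  qed
  then have "X *\<^sub>v indicator_vec n U = indicator_vec p T" using \<open>X \<in> P\<close> mem_pattern_iff[OF P, of X]
    by (intro eq_vecI) (auto simp: indicator_vec_def s_def)
  with \<open>X \<in> P\<close> show ?thesis by (rule that)
qed

lemma pattern_annihilation:
  fixes P :: "'a::real_or_complex mat set"
  assumes "P \<in> patterns p n" and "U \<subseteq> {..<n}"
    and "\<And>i. i < p \<Longrightarrow> \<not> isolates (star_entry P) i U"
  obtains X where "X \<in> P" "X *\<^sub>v indicator_vec n U = 0\<^sub>v p"
proof -
  have "indicator_vec p {} = (0\<^sub>v p :: 'a vec)" by (auto simp: indicator_vec_def)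
  then show ?thesis using pattern_realization[OF assms(1,2), of "{}"] assms(3) that by auto
qed

section \<open>Observability in terms of the free response\<close>

primrec free_response :: "(int \<Rightarrow> 'a::semiring_0 mat) \<Rightarrow> int \<Rightarrow> 'a vec \<Rightarrow> nat \<Rightarrow> 'a vec" where
  "free_response A t\<^sub>0 x 0 = x"
| "free_response A t\<^sub>0 x (Suc k) = A (t\<^sub>0 + int k) *\<^sub>v free_response A t\<^sub>0 x k"

lemma free_response_carrier:
  assumes "dt_system n r m A B C D" "x \<in> carrier_vec n"
  shows "free_response A t\<^sub>0 x k \<in> carrier_vec n"
proof (induction k)
  case (Suc k)
  have "A (t\<^sub>0 + int k) \<in> carrier_mat n n" using assms by (simp add: dt_system_def)
  then show ?case using Suc mult_mat_vec_carrier by simp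
qed (use assms in simp)

text \<open>The input cancels in differences, so that indistinguishability is a statement about the
  free response to \<open>x - y\<close>.\<close>
lemma steps_diff:
  fixes A B :: "int \<Rightarrow> 'a::real_or_complex mat"
  assumes S: "dt_system n r m A B C D" and x: "x \<in> carrier_vec n" "y \<in> carrier_vec n"
    and u: "\<And>j. j < k \<Longrightarrow> u (t\<^sub>0 + int j) \<in> carrier_vec r"
  shows "steps A B t\<^sub>0 x u k \<in> carrier_vec n \<and> steps A B t\<^sub>0 y u k \<in> carrier_vec n \<and>
    steps A B t\<^sub>0 x u k - steps A B t\<^sub>0 y u k = free_response A t\<^sub>0 (x - y) k"
  using u
proof (induction k)
  case 0
  then show ?case using x by simp
next
  case (Suc k)
  define At Bt ut p q where "At = A (t\<^sub>0 + int k)" and "Bt = B (t\<^sub>0 + int k)"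
    and "ut = u (t\<^sub>0 + int k)" and "p = steps A B t\<^sub>0 x u k" and "q = steps A B t\<^sub>0 y u k"
  have At: "At \<in> carrier_mat n n" and "Bt \<in> carrier_mat n r"
    using S by (auto simp: dt_system_def At_def Bt_def)
  moreover have "ut \<in> carrier_vec r" using Suc.prems by (simp add: ut_def)
  ultimately have Bu: "Bt *\<^sub>v ut \<in> carrier_vec n" using mult_mat_vec_carrier by blast
  have pq: "p \<in> carrier_vec n" "q \<in> carrier_vec n"
    and diff: "p - q = free_response A t\<^sub>0 (x - y) k"
    using Suc by (auto simp: p_def q_def)
  have Apq: "At *\<^sub>v p \<in> carrier_vec n" "At *\<^sub>v q \<in> carrier_vec n"
    using At pq by (auto intro: mult_mat_vec_carrier)
  have "(At *\<^sub>v p + Bt *\<^sub>v ut) - (At *\<^sub>v q + Bt *\<^sub>v ut) = At *\<^sub>v p - At *\<^sub>v q"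
  proof -
    have "(a + c) - (b + c) = a - b"
      if "a \<in> carrier_vec n" "b \<in> carrier_vec n" "c \<in> carrier_vec n" for a b c :: "'a vec"
      using that by (intro eq_vecI) auto
    then show ?thesis using Apq Bu by blast
  qed
  also have "\<dots> = At *\<^sub>v (p - q)"
    using mult_minus_distrib_mat_vec[OF At pq] by simp
  finally show ?case
    using Apq Bu diff by (simp add: At_def Bt_def ut_def p_def q_def)
qed

lemma indistinguishable_iff_free_response:
  fixes A B C :: "int \<Rightarrow> 'a::real_or_complex mat"
  assumes S: "dt_system n r m A B C D" and x: "x \<in> carrier_vec n" "y \<in> carrier_vec n"
  shows "indistinguishable n r A B C \<tau>\<^sub>0 \<tau>\<^sub>1 x y \<longleftrightarrow>
    (\<forall>k. int k < \<tau>\<^sub>1 - \<tau>\<^sub>0 \<longrightarrow> C (\<tau>\<^sub>0 + int k) *\<^sub>v free_response A \<tau>\<^sub>0 (x - y) k = 0\<^sub>v m)"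
proof -
  have out: "C (\<tau>\<^sub>0 + int k) *\<^sub>v solution A B (\<tau>\<^sub>0 + int k) \<tau>\<^sub>0 x u =
        C (\<tau>\<^sub>0 + int k) *\<^sub>v solution A B (\<tau>\<^sub>0 + int k) \<tau>\<^sub>0 y u \<longleftrightarrow>
      C (\<tau>\<^sub>0 + int k) *\<^sub>v free_response A \<tau>\<^sub>0 (x - y) k = 0\<^sub>v m"
    if k: "int k < \<tau>\<^sub>1 - \<tau>\<^sub>0" and u: "\<forall>s\<in>{\<tau>\<^sub>0..<\<tau>\<^sub>1}. u s \<in> carrier_vec r" for k u
  proof -
    define Ct p q where "Ct = C (\<tau>\<^sub>0 + int k)" and "p = steps A B \<tau>\<^sub>0 x u k"
      and "q = steps A B \<tau>\<^sub>0 y u k"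
    have Ct: "Ct \<in> carrier_mat m n" using S by (simp add: dt_system_def Ct_def)
    have pq: "p \<in> carrier_vec n" "q \<in> carrier_vec n"
      and diff: "p - q = free_response A \<tau>\<^sub>0 (x - y) k"
      using steps_diff[OF S x, of k u \<tau>\<^sub>0] u k by (auto simp: p_def q_def)
    have "Ct *\<^sub>v (p - q) = Ct *\<^sub>v p - Ct *\<^sub>v q"
      using mult_minus_distrib_mat_vec[OF Ct pq] .
    moreover have "Ct *\<^sub>v p \<in> carrier_vec m" "Ct *\<^sub>v q \<in> carrier_vec m"
      using Ct pq by (auto intro: mult_mat_vec_carrier)
    moreover have "a = b \<longleftrightarrow> a - b = 0\<^sub>v m"
      if "a \<in> carrier_vec m" "b \<in> carrier_vec m" for a b :: "'a vec"
      using that by (auto simp: vec_eq_iff)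
    ultimately have "Ct *\<^sub>v p = Ct *\<^sub>v q \<longleftrightarrow> Ct *\<^sub>v (p - q) = 0\<^sub>v m" by metis
    then show ?thesis unfolding diff by (simp add: solution_def Ct_def p_def q_def)
  qed
  show ?thesis
  proof
    assume L: "indistinguishable n r A B C \<tau>\<^sub>0 \<tau>\<^sub>1 x y"
    show "\<forall>k. int k < \<tau>\<^sub>1 - \<tau>\<^sub>0 \<longrightarrow>
        C (\<tau>\<^sub>0 + int k) *\<^sub>v free_response A \<tau>\<^sub>0 (x - y) k = 0\<^sub>v m"
    proof (intro allI impI)
      fix k assume k: "int k < \<tau>\<^sub>1 - \<tau>\<^sub>0"
      have "\<tau>\<^sub>0 + int k \<in> {\<tau>\<^sub>0..<\<tau>\<^sub>1}" using k by simp
      then have "C (\<tau>\<^sub>0 + int k) *\<^sub>v solution A B (\<tau>\<^sub>0 + int k) \<tau>\<^sub>0 x (\<lambda>_. 0\<^sub>v r) =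
          C (\<tau>\<^sub>0 + int k) *\<^sub>v solution A B (\<tau>\<^sub>0 + int k) \<tau>\<^sub>0 y (\<lambda>_. 0\<^sub>v r)"
        using L unfolding indistinguishable_def by simp
      then show "C (\<tau>\<^sub>0 + int k) *\<^sub>v free_response A \<tau>\<^sub>0 (x - y) k = 0\<^sub>v m"
        using out[OF k, of "\<lambda>_. 0\<^sub>v r"] by simp
    qed
  next
    assume R: "\<forall>k. int k < \<tau>\<^sub>1 - \<tau>\<^sub>0 \<longrightarrow>
        C (\<tau>\<^sub>0 + int k) *\<^sub>v free_response A \<tau>\<^sub>0 (x - y) k = 0\<^sub>v m"
    show "indistinguishable n r A B C \<tau>\<^sub>0 \<tau>\<^sub>1 x y"
      unfolding indistinguishable_def
    proof (intro conjI x allI impI ballI)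
      fix u :: "int \<Rightarrow> 'a vec" and t
      assume u: "\<forall>s\<in>{\<tau>\<^sub>0..<\<tau>\<^sub>1}. u s \<in> carrier_vec r" and t: "t \<in> {\<tau>\<^sub>0..<\<tau>\<^sub>1}"
      obtain k where "t = \<tau>\<^sub>0 + int k" using t zero_le_imp_eq_int[of "t - \<tau>\<^sub>0"]
        by (auto simp: algebra_simps)
      then show "C t *\<^sub>v solution A B t \<tau>\<^sub>0 x u = C t *\<^sub>v solution A B t \<tau>\<^sub>0 y u"
        using out[OF _ u, of k] R t by simp
    qed
  qed
qed

lemma not_observable_on_iff:
  fixes A B C :: "int \<Rightarrow> 'a::real_or_complex mat"
  assumes S: "dt_system n r m A B C D"
  shows "\<not> observable_on n r A B C t\<^sub>0 t\<^sub>1 \<longleftrightarrow> (\<exists>z\<in>carrier_vec n. z \<noteq> 0\<^sub>v n \<and>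
    (\<forall>k. int k < t\<^sub>1 - t\<^sub>0 \<longrightarrow> C (t\<^sub>0 + int k) *\<^sub>v free_response A t\<^sub>0 z k = 0\<^sub>v m))" (is "?L \<longleftrightarrow> ?R")
proof
  assume ?L
  then obtain x y where xy: "x \<in> carrier_vec n" "y \<in> carrier_vec n" "x \<noteq> y"
    "indistinguishable n r A B C t\<^sub>0 t\<^sub>1 x y" unfolding observable_on_def by blast
  then have "x - y \<noteq> 0\<^sub>v n" by (auto simp: vec_eq_iff)
  with xy indistinguishable_iff_free_response[OF S xy(1,2)] show ?R
    by (intro bexI[of _ "x - y"]) auto
next
  assume ?R
  then obtain z where z: "z \<in> carrier_vec n" "z \<noteq> 0\<^sub>v n"
    "\<forall>k. int k < t\<^sub>1 - t\<^sub>0 \<longrightarrow> C (t\<^sub>0 + int k) *\<^sub>v free_response A t\<^sub>0 z k = 0\<^sub>v m" by blast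
  then have "indistinguishable n r A B C t\<^sub>0 t\<^sub>1 z (0\<^sub>v n)"
    using indistinguishable_iff_free_response[OF S z(1), of "0\<^sub>v n"] by simp
  then show ?L using z unfolding observable_on_def by (meson zero_carrier_vec)
qed

section \<open>The graph of the block pattern\<close>

lemma star_entry_adjoint:
  fixes P :: "'a::conjugatable_field mat set"
  assumes "P \<in> patterns p q" "i < q" "j < p"
  shows "star_entry (pattern_adjoint P) i j \<longleftrightarrow> star_entry P j i"
proof -
  obtain X where X: "X \<in> carrier_mat p q" "P = pattern_of X"
    using assms(1) patterns_nonempty patterns_pattern_of by blast
  have "star_entry (pattern_adjoint P) i j \<longleftrightarrow> mat_adjoint X $$ (i, j) \<noteq> 0"
    unfolding X(2) pattern_adjoint_pattern_of[OF X(1)]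
    using star_entry_pattern_of[OF mat_adjoint_carrier[OF X(1)] assms(2,3)] .
  then show ?thesis
    using star_entry_pattern_of[OF X(1) assms(3,2)] X assms by (simp add: mat_adjoint_index)
qed

lemma star_entry_juxtapose:
  fixes P Q :: "'a::zero mat set"
  assumes "P \<in> patterns p q" "Q \<in> patterns p s" "i < p" "j < q + s"
  shows "star_entry (pattern_juxtapose P Q) i j \<longleftrightarrow>
    (if j < q then star_entry P i j else star_entry Q i (j - q))"
proof -
  obtain X where X: "X \<in> carrier_mat p q" "P = pattern_of X"
    using assms(1) patterns_nonempty patterns_pattern_of by blast
  obtain Y where Y: "Y \<in> carrier_mat p s" "Q = pattern_of Y"
    using assms(2) patterns_nonempty patterns_pattern_of by blast
  have "star_entry (pattern_juxtapose P Q) i j \<longleftrightarrow> juxtapose X Y $$ (i, j) \<noteq> 0"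
    unfolding X(2) Y(2) pattern_juxtapose_pattern_of[OF X(1) Y(1)]
    using star_entry_pattern_of[OF juxtapose_carrier[OF X(1) Y(1)] assms(3,4)] .
  also have "\<dots> \<longleftrightarrow> (if j < q then X $$ (i, j) \<noteq> 0 else Y $$ (i, j - q) \<noteq> 0)"
    using X(1) Y(1) assms(3,4) by (simp add: juxtapose_def)
  finally show ?thesis
    using star_entry_pattern_of[OF X(1) assms(3), of j]
      star_entry_pattern_of[OF Y(1) assms(3), of "j - q"] X(2) Y(2) assms(4) by simp
qed

lemma block_entry:
  assumes "block X h w i\<^sub>0 j\<^sub>0 \<in> Q" "Q \<in> patterns h w" "a < h" "b < w"
  shows "X $$ (i\<^sub>0 + a, j\<^sub>0 + b) \<noteq> 0 \<longleftrightarrow> star_entry Q a b"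
proof -
  have "block X h w i\<^sub>0 j\<^sub>0 $$ (a, b) \<noteq> 0 \<longleftrightarrow> star_entry Q a b"
    using mem_pattern_iff[OF assms(2)] assms by blast
  then show ?thesis using assms(3,4) by (simp add: block_def)
qed

lemma block_index_bound:
  fixes i a h N :: nat
  assumes "i < N" "a < h"
  shows "i * h + a < h * N"
  using block_index_less[of "Suc i" N a h] assms by simp

lemma block_index_cases:
  fixes k h N :: nat
  assumes "k < h * N"
  obtains i a where "i < N" "a < h" "k = i * h + a"
proof -
  obtain i a where "i \<in> {1..N}" "a < h" "k = (i - 1) * h + a"
    using block_index_decomp[OF assms] .
  then show ?thesis using that[of "i - 1" a] by auto
qed

lemma block_index_inject:
  fixes i j a b h :: nat
  assumes "a < h" "b < h"
  shows "i * h + a = j * h + b \<longleftrightarrow> i = j \<and> a = b"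
proof
  assume eq: "i * h + a = j * h + b"
  have "(i * h + a) div h = i" "(j * h + b) div h = j"
    "(i * h + a) mod h = a" "(j * h + b) mod h = b" using assms by auto
  then show "i = j \<and> a = b" using eq by simp
qed simp

lemma is_singleton_iff_ex1: "is_singleton S \<longleftrightarrow> (\<exists>!x. x \<in> S)"
  by (auto simp: is_singleton_def)

lemma ex1_image_iff:
  assumes "inj g"
  shows "(\<exists>!w. \<exists>a. P a \<and> w = g a) \<longleftrightarrow> (\<exists>!a. P a)"
proof -
  have "(\<exists>!w. \<exists>a. P a \<and> w = g a) \<longleftrightarrow> is_singleton {w. \<exists>a. P a \<and> w = g a}"
    by (simp only: is_singleton_iff_ex1 mem_Collect_eq)
  also have "{w. \<exists>a. P a \<and> w = g a} = g ` {a. P a}" by blast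
  also have "is_singleton (g ` {a. P a}) \<longleftrightarrow> is_singleton {a. P a}"
    using assms by (simp add: is_singleton_altdef card_image inj_on_subset)
  also have "\<dots> \<longleftrightarrow> (\<exists>!a. P a)"
    by (simp only: is_singleton_iff_ex1 mem_Collect_eq)
  finally show ?thesis .
qed

lemma ex1_insert_image_iff:
  assumes "\<And>a. P a \<Longrightarrow> z \<noteq> g a"
  shows "(\<exists>!w. w = z \<or> (\<exists>a. P a \<and> w = g a)) \<longleftrightarrow> \<not> (\<exists>a. P a)"
  using assms by metis

text \<open>Vertex \<open>Suc (j * n + a)\<close> of \<open>\<G>(\<K>)\<close> stands for the state component \<open>a\<close> in the 0-based block row
  \<open>j\<close>.\<close>
definition slice :: "nat \<Rightarrow> nat set \<Rightarrow> nat \<Rightarrow> nat set" where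
  "slice n V j = {a. a < n \<and> Suc (j * n + a) \<in> V}"

context
  fixes \<A> \<C> :: "'a::real_or_complex mat set" and n m N :: nat
  assumes \<A>: "\<A> \<in> patterns n n" and \<C>: "\<C> \<in> patterns m n"
begin

lemma star_entry_block_pattern_state:
  assumes i: "i < N" "a < n" and j: "j < N" "b < n"
  shows "star_entry (block_pattern n m N \<A> \<C>) (i * n + a) (j * n + b) \<longleftrightarrow>
    (j = Suc i \<and> a = b) \<or> (j = i \<and> 0 < i \<and> star_entry \<A> b a)"
proof -
  have K: "block_pattern n m N \<A> \<C> \<in> patterns (n * N) ((n + m) * N)"
    using block_pattern_in_patterns[OF \<A> \<C>] .
  then obtain X where X: "X \<in> block_pattern n m N \<A> \<C>" using patterns_nonempty by blast
  define Q where "Q = (if j = Suc i then pattern_of (1\<^sub>m n :: 'a mat)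
    else if j = i \<and> 0 < i then pattern_adjoint \<A> else pattern_of (0\<^sub>m n n))"
  have Q: "Q \<in> patterns n n"
    using \<A> by (auto simp: Q_def intro: pattern_of_in_patterns pattern_adjoint_in_patterns)
  have "\<forall>i\<in>{1..N}. \<forall>j\<in>{1..N}. block X n n ((i - 1) * n) ((j - 1) * n) \<in>
      (if j = i + 1 then pattern_of (1\<^sub>m n)
       else if j = i \<and> 2 \<le> i then pattern_adjoint \<A> else pattern_of (0\<^sub>m n n))"
    using X unfolding block_pattern_def by blast
  from this[rule_format, of "Suc i" "Suc j"]
  have "block X n n (i * n) (j * n) \<in> Q"
    using i j by (auto simp: Q_def split: if_splits)
  then have "X $$ (i * n + a, j * n + b) \<noteq> 0 \<longleftrightarrow> star_entry Q a b"
    using block_entry Q i j by blast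
  moreover have "i * n + a < n * N" "j * n + b < (n + m) * N"
    using block_index_bound[OF i] block_index_bound[OF j] by (simp_all add: algebra_simps)
  ultimately have "star_entry (block_pattern n m N \<A> \<C>) (i * n + a) (j * n + b) \<longleftrightarrow>
      star_entry Q a b"
    using mem_pattern_iff[OF K, of X] X by blast
  also have "\<dots> \<longleftrightarrow> (j = Suc i \<and> a = b) \<or> (j = i \<and> 0 < i \<and> star_entry \<A> b a)"
    using i(2) j(2) star_entry_adjoint[OF \<A>, of a b]
    by (auto simp: Q_def star_entry_pattern_of[of _ n n])
  finally show ?thesis .
qed

lemma star_entry_block_pattern_output:
  assumes i: "i < N" "a < n" and j: "j < N" "c < m"
  shows "star_entry (block_pattern n m N \<A> \<C>) (i * n + a) (N * n + (j * m + c)) \<longleftrightarrow>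
    j = i \<and> star_entry \<C> c a"
proof -
  have K: "block_pattern n m N \<A> \<C> \<in> patterns (n * N) ((n + m) * N)"
    using block_pattern_in_patterns[OF \<A> \<C>] .
  then obtain X where X: "X \<in> block_pattern n m N \<A> \<C>" using patterns_nonempty by blast
  define Q where "Q = (if j = i then pattern_adjoint \<C> else pattern_of (0\<^sub>m n m))"
  have Q: "Q \<in> patterns n m"
    using \<C> by (auto simp: Q_def intro: pattern_of_in_patterns pattern_adjoint_in_patterns)
  have "\<forall>i\<in>{1..N}. \<forall>j\<in>{1..N}. block X n m ((i - 1) * n) (N * n + (j - 1) * m) \<in>
      (if j = i then pattern_adjoint \<C> else pattern_of (0\<^sub>m n m))"
    using X unfolding block_pattern_def by blast
  from this[rule_format, of "Suc i" "Suc j"]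
  have "block X n m (i * n) (N * n + j * m) \<in> Q"
    using i j by (auto simp: Q_def split: if_splits)
  then have "X $$ (i * n + a, N * n + j * m + c) \<noteq> 0 \<longleftrightarrow> star_entry Q a c"
    using block_entry Q i j by blast
  moreover have "i * n + a < n * N" "N * n + (j * m + c) < (n + m) * N"
    using block_index_bound[OF i] block_index_bound[OF j] by (simp_all add: algebra_simps)
  ultimately have "star_entry (block_pattern n m N \<A> \<C>) (i * n + a) (N * n + (j * m + c)) \<longleftrightarrow>
      star_entry Q a c"
    using mem_pattern_iff[OF K, of X] X by (simp add: add.assoc)
  also have "\<dots> \<longleftrightarrow> j = i \<and> star_entry \<C> c a"
    using i(2) j(2) star_entry_adjoint[OF \<C>, of a c]
    by (auto simp: Q_def star_entry_pattern_of[of _ n m])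
  finally show ?thesis .
qed

abbreviation (input) arcsK where
  "arcsK \<equiv> parcs (pattern_graph (n * N) ((n + m) * N) (block_pattern n m N \<A> \<C>))"

lemma state_arc_iff:
  assumes i: "i < N" "a < n" and j: "j < N" "b < n"
  shows "(Suc (j * n + b), Suc (i * n + a)) \<in> arcsK \<longleftrightarrow>
    (j = Suc i \<and> a = b) \<or> (j = i \<and> 0 < i \<and> star_entry \<A> b a)"
  using star_entry_block_pattern_state[OF i j] block_index_bound[OF i] block_index_bound[OF j]
  by (auto simp: pattern_graph_def algebra_simps)

lemma output_arc_iff:
  assumes i: "i < N" "a < n" and j: "j < N" "c < m"
  shows "(Suc (N * n + (j * m + c)), Suc (i * n + a)) \<in> arcsK \<longleftrightarrow> j = i \<and> star_entry \<C> c a"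
  using star_entry_block_pattern_output[OF i j] block_index_bound[OF i] block_index_bound[OF j]
  by (auto simp: pattern_graph_def algebra_simps)

lemma vertex_cases:
  assumes "V \<subseteq> {1..n * N}" "w \<in> V"
  obtains i a where "i < N" "a \<in> slice n V i" "a < n" "w = Suc (i * n + a)"
proof -
  have "1 \<le> w" "w \<le> n * N" using assms by auto
  then have "w - 1 < n * N" "w = Suc (w - 1)" by auto
  then obtain i a where "i < N" "a < n" "w = Suc (i * n + a)"
    using block_index_cases[of "w - 1" n N] by metis
  with assms(2) show ?thesis using that by (simp add: slice_def)
qed

lemma unique_successor_output:
  assumes V: "V \<subseteq> {1..n * N}" and j: "j < N" "c < m"
  shows "(\<exists>!w. w \<in> V \<and> (Suc (N * n + (j * m + c)), w) \<in> arcsK) \<longleftrightarrow>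
    isolates (star_entry \<C>) c (slice n V j)"
proof -
  have succ: "w \<in> V \<and> (Suc (N * n + (j * m + c)), w) \<in> arcsK \<longleftrightarrow>
      (\<exists>a. (a \<in> slice n V j \<and> star_entry \<C> c a) \<and> w = Suc (j * n + a))" (is "?L \<longleftrightarrow> ?R") for w
  proof
    assume w: ?L
    then obtain i a where ia: "i < N" "a \<in> slice n V i" "a < n" "w = Suc (i * n + a)"
      using vertex_cases[OF V] by metis
    then have "j = i \<and> star_entry \<C> c a"
      using w output_arc_iff[OF ia(1,3) j] by blast
    then show ?R using ia by blast
  next
    assume ?R
    then obtain a where a: "a \<in> slice n V j" "star_entry \<C> c a" "w = Suc (j * n + a)" by blast
    then have "a < n" "w \<in> V" by (simp_all add: slice_def)
    then show ?L using a output_arc_iff[OF j(1) _ j] by blast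
  qed
  show ?thesis unfolding succ isolates_def by (rule ex1_image_iff) (simp add: inj_def)
qed

text \<open>The column \<open>(j, b)\<close> of \<open>\<K>\<close> is the scalar equation that determines component \<open>b\<close> of the state of
  block \<open>j - 1\<close> from the state of block \<open>j\<close>; the first block column is zero. Time therefore runs
  against the block numbering.\<close>
lemma unique_successor_state:
  assumes V: "V \<subseteq> {1..n * N}" and j: "j < N" "b < n"
  shows "(\<exists>!w. w \<in> V \<and> (Suc (j * n + b), w) \<in> arcsK) \<longleftrightarrow> 0 < j \<and>
    (if b \<in> slice n V (j - 1) then \<not> (\<exists>a\<in>slice n V j. star_entry \<A> b a)
     else isolates (star_entry \<A>) b (slice n V j))"
proof -
  have succ: "w \<in> V \<and> (Suc (j * n + b), w) \<in> arcsK \<longleftrightarrow> 0 < j \<and>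
      (b \<in> slice n V (j - 1) \<and> w = Suc ((j - 1) * n + b) \<or>
       (\<exists>a. (a \<in> slice n V j \<and> star_entry \<A> b a) \<and> w = Suc (j * n + a)))" (is "?L \<longleftrightarrow> ?R") for w
  proof
    assume w: ?L
    then obtain i a where ia: "i < N" "a \<in> slice n V i" "a < n" "w = Suc (i * n + a)"
      using vertex_cases[OF V] by metis
    then consider "j = Suc i" "a = b" | "j = i" "0 < i" "star_entry \<A> b a"
      using w state_arc_iff[OF ia(1,3) j] by blast
    then show ?R
    proof cases
      case 1
      then show ?thesis using ia by simp
    next
      case 2
      then show ?thesis using ia by blast
    qed
  next
    assume R: ?R
    then consider "b \<in> slice n V (j - 1)" "w = Suc ((j - 1) * n + b)"
      | a where "a \<in> slice n V j" "star_entry \<A> b a" "w = Suc (j * n + a)" by blast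
    then show ?L
    proof cases
      case 1
      have "j - 1 < N" "j = Suc (j - 1)" "w \<in> V" using 1 R j by (auto simp: slice_def)
      then show ?thesis using 1(2) state_arc_iff[OF _ j(2) j] by blast
    next
      case 2
      then have "a < n" "w \<in> V" by (simp_all add: slice_def)
      then show ?thesis using 2 R state_arc_iff[OF j(1) _ j] by blast
    qed
  qed
  have disj: "Suc ((j - 1) * n + b) \<noteq> Suc (j * n + a)" if "0 < j" "a \<in> slice n V j" for a
  proof -
    have "a < n" "j - 1 \<noteq> j" using that by (auto simp: slice_def)
    then show ?thesis using block_index_inject[OF j(2), of a "j - 1" j] by blast
  qed
  consider "j = 0" | "0 < j" "b \<in> slice n V (j - 1)" | "0 < j" "b \<notin> slice n V (j - 1)" by blast
  then show ?thesis
  proof cases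
    case 1
    have "\<not> (\<exists>!w::nat. False)" by blast
    then show ?thesis unfolding succ using 1 by (simp only: less_irrefl simp_thms not_False_eq_True)
  next
    case 2
    have "(\<exists>!w. w = Suc ((j - 1) * n + b) \<or>
        (\<exists>a. (a \<in> slice n V j \<and> star_entry \<A> b a) \<and> w = Suc (j * n + a))) \<longleftrightarrow>
        \<not> (\<exists>a. a \<in> slice n V j \<and> star_entry \<A> b a)"
      using disj 2(1) by (intro ex1_insert_image_iff) blast
    then show ?thesis unfolding succ using 2 by (simp only: simp_thms if_True Bex_def refl)
  next
    case 3
    have "(\<exists>!w. \<exists>a. (a \<in> slice n V j \<and> star_entry \<A> b a) \<and> w = Suc (j * n + a)) \<longleftrightarrow>
        isolates (star_entry \<A>) b (slice n V j)"
      unfolding isolates_def by (rule ex1_image_iff) (simp add: inj_def)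
    then show ?thesis unfolding succ using 3 by (simp only: simp_thms if_False)
  qed
qed

lemma column_cases:
  assumes "v \<in> {1..(n + m) * N}"
  obtains j b where "j < N" "b < n" "v = Suc (j * n + b)"
    | j c where "j < N" "c < m" "v = Suc (N * n + (j * m + c))"
proof (cases "v - 1 < n * N")
  case True
  then obtain j b where "j < N" "b < n" "v - 1 = j * n + b" by (rule block_index_cases)
  moreover from this(3) have "v = Suc (j * n + b)" using assms by auto
  ultimately show ?thesis using that(1) by blast
next
  case False
  have "v - 1 - N * n < m * N" using assms False by (auto simp: algebra_simps)
  then obtain j c where jc: "j < N" "c < m" "v - 1 - N * n = j * m + c" by (rule block_index_cases)
  then have "v = Suc (N * n + (j * m + c))" using assms False by (auto simp: algebra_simps)
  with jc show ?thesis using that(2) by blast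
qed

text \<open>The index \<open>N - Suc k\<close> reverses time, because the initial state sits in the last block.\<close>
lemma no_unique_successor_iff:
  assumes V: "V \<subseteq> {1..n * N}"
  shows "(\<forall>v\<in>{1..(n + m) * N}. \<not> (\<exists>!w. w \<in> V \<and> (v, w) \<in> arcsK)) \<longleftrightarrow>
    silent_supports (star_entry \<A>) (star_entry \<C>) n m N (\<lambda>k. slice n V (N - Suc k))"
    (is "?L \<longleftrightarrow> ?R")
proof
  assume L: ?L
  have out: "\<not> isolates (star_entry \<C>) c (slice n V j)" if "j < N" "c < m" for j c
  proof -
    have "Suc (N * n + (j * m + c)) \<in> {1..(n + m) * N}"
      using block_index_bound[OF that] by (simp add: algebra_simps)
    then show ?thesis using L unique_successor_output[OF V that] by blast
  qed
  have state: "\<not> (if b \<in> slice n V (j - 1) then \<not> (\<exists>a\<in>slice n V j. star_entry \<A> b a)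
      else isolates (star_entry \<A>) b (slice n V j))" if "0 < j" "j < N" "b < n" for j b
  proof -
    have "Suc (j * n + b) \<in> {1..(n + m) * N}"
      using block_index_bound[OF that(2,3)] by (simp add: algebra_simps)
    then show ?thesis using L unique_successor_state[OF V that(2,3)] that(1) by blast
  qed
  show ?R unfolding silent_supports_def
  proof (intro conjI allI impI ballI)
    fix k assume k: "Suc k < N"
    then have k': "0 < N - Suc k" "N - Suc k < N" "N - Suc (Suc k) = N - Suc k - 1" by auto
    show "b \<in> slice n V (N - Suc (Suc k))"
      if "b < n" "isolates (star_entry \<A>) b (slice n V (N - Suc k))" for b
      using state[OF k'(1,2) that(1)] that(2) unfolding k'(3) by argo
    show "\<exists>a\<in>slice n V (N - Suc k). star_entry \<A> b a" if "b \<in> slice n V (N - Suc (Suc k))" for b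
    proof -
      have "b < n" using that by (simp add: slice_def)
      then show ?thesis using state[OF k'(1,2), of b] that unfolding k'(3) by argo
    qed
  qed (use out in \<open>auto simp: slice_def\<close>)
next
  assume R: ?R
  show ?L
  proof
    fix v assume "v \<in> {1..(n + m) * N}"
    then show "\<not> (\<exists>!w. w \<in> V \<and> (v, w) \<in> arcsK)"
    proof (cases rule: column_cases)
      case (1 j b)
      have False if j0: "0 < j" and u: "if b \<in> slice n V (j - 1)
        then \<not> (\<exists>a\<in>slice n V j. star_entry \<A> b a) else isolates (star_entry \<A>) b (slice n V j)"
      proof -
        define k where "k = N - Suc j"
        have k: "Suc k < N" "N - Suc k = j" "N - Suc (Suc k) = j - 1"
          using 1(1) j0 by (auto simp: k_def)
        show ?thesis
          using silent_supports_step[OF R k(1) 1(2)] silent_supports_pred[OF R k(1), of b] u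
          unfolding k(2,3) by argo
      qed
      then show ?thesis using unique_successor_state[OF V 1(1,2)] 1(3) by blast
    next
      case (2 j c)
      have "N - Suc (N - Suc j) = j" "N - Suc j < N" using 2(1) by auto
      then have "\<not> isolates (star_entry \<C>) c (slice n V j)"
        using silent_supports_output[OF R, of "N - Suc j" c] 2(2) by simp
      then show ?thesis using unique_successor_output[OF V 2(1,2)] 2(3) by blast
    qed
  qed
qed

lemma condition_G3_iff:
  "condition_G3 (n * N) ((n + m) * N)
      (pattern_graph (n * N) ((n + m) * N) (block_pattern n m N \<A> \<C>)) \<longleftrightarrow>
    \<not> (\<exists>V. silent_supports (star_entry \<A>) (star_entry \<C>) n m N V \<and> (\<exists>k<N. V k \<noteq> {}))"
    (is "?G \<longleftrightarrow> \<not> ?S")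
proof -
  have "\<not> ?G \<longleftrightarrow> (\<exists>V\<subseteq>{1..n * N}. V \<noteq> {} \<and>
      silent_supports (star_entry \<A>) (star_entry \<C>) n m N (\<lambda>k. slice n V (N - Suc k)))"
    (is "_ \<longleftrightarrow> ?T")
  proof -
    have neg: "\<not> (\<forall>V\<subseteq>S. V \<noteq> {} \<longrightarrow> P V) \<longleftrightarrow> (\<exists>V\<subseteq>S. V \<noteq> {} \<and> Q V)"
      if "\<And>V. V \<subseteq> S \<Longrightarrow> \<not> P V \<longleftrightarrow> Q V" for S :: "nat set" and P Q
      using that by blast
    show ?thesis
      unfolding condition_G3_def
      by (rule neg) (simp only: bex_simps no_unique_successor_iff)
  qed
  also have "\<dots> \<longleftrightarrow> ?S"
  proof
    assume ?T
    then obtain V where V: "V \<subseteq> {1..n * N}" "V \<noteq> {}"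
      "silent_supports (star_entry \<A>) (star_entry \<C>) n m N (\<lambda>k. slice n V (N - Suc k))" by blast
    then obtain w where "w \<in> V" by blast
    then obtain i a where ia: "i < N" "a \<in> slice n V i" using vertex_cases[OF V(1)] by metis
    have "N - Suc i < N" "N - Suc (N - Suc i) = i" using ia(1) by auto
    then show ?S using V(3) ia(2) by (intro exI[of _ "\<lambda>k. slice n V (N - Suc k)"]) force
  next
    assume ?S
    then obtain W l where W: "silent_supports (star_entry \<A>) (star_entry \<C>) n m N W"
      and l: "l < N" "W l \<noteq> {}" by blast
    define V where "V = {Suc (j * n + a) | j a. j < N \<and> a \<in> W (N - Suc j)}"
    have bound: "a < n" if "j < N" "a \<in> W (N - Suc j)" for j a
      using silent_supports_subset[OF W, of "N - Suc j"] that by auto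
    have slice: "slice n V (N - Suc k) = W k" if "k < N" for k
    proof -
      have k: "N - Suc k < N" "N - Suc (N - Suc k) = k" using that by auto
      show ?thesis
      proof (intro Set.set_eqI iffI)
        fix a assume "a \<in> slice n V (N - Suc k)"
        then obtain j a' where "a < n" "j < N" "a' \<in> W (N - Suc j)"
          "(N - Suc k) * n + a = j * n + a'" by (auto simp: slice_def V_def)
        then show "a \<in> W k"
          using block_index_inject[of a n a' "N - Suc k" j] bound k by auto
      next
        fix a assume "a \<in> W k"
        then have a: "a \<in> W (N - Suc (N - Suc k))" using k(2) by simp
        then have "Suc ((N - Suc k) * n + a) \<in> V" unfolding V_def using k(1) by blast
        then show "a \<in> slice n V (N - Suc k)" using bound[OF k(1) a] by (simp add: slice_def)
      qed
    qed
    have "silent_supports (star_entry \<A>) (star_entry \<C>) n m N (\<lambda>k. slice n V (N - Suc k))"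
      using W slice by (simp add: silent_supports_def)
    moreover have "V \<subseteq> {1..n * N}"
    proof
      fix w assume "w \<in> V"
      then obtain j a where "j < N" "a < n" "w = Suc (j * n + a)"
        using bound by (auto simp: V_def)
      then show "w \<in> {1..n * N}" using block_index_bound[of j N a n] by simp
    qed
    moreover have "V \<noteq> {}" using slice[OF l(1)] l(2) by (auto simp: slice_def)
    ultimately show ?T by blast
  qed
  finally show ?thesis by blast
qed

end

section \<open>The graph of the adjoint patterns\<close>

text \<open>An arc from \<open>Suc b\<close> to \<open>Suc a\<close> is a star of \<open>\<A>\<close> in row \<open>b\<close> and column \<open>a\<close>, so \<open>V \<subseteq> Pre(V)\<close> says
  that every row with index in \<open>V\<close> meets \<open>V\<close>. A set that violates (a) or (b) is an invariant
  support of the first or of the second kind.\<close>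
lemma graph_conditions_iff:
  fixes \<A> \<C> :: "'a::real_or_complex mat set"
  assumes \<A>: "\<A> \<in> patterns n n" and \<C>: "\<C> \<in> patterns m n"
    and G: "G = pattern_graph n (n + m) (pattern_juxtapose (pattern_adjoint \<A>) (pattern_adjoint \<C>))"
  shows "(\<forall>V\<subseteq>{1..n}. V \<noteq> {} \<longrightarrow> (\<exists>v\<in>{1..n + m}. is_singleton (V \<inter> Post G {v}))) \<and>
      (\<forall>V\<subseteq>{1..n}. V \<noteq> {} \<and> V \<subseteq> Pre G V \<longrightarrow>
         (\<exists>v\<in>{1..n + m} - V. is_singleton (V \<inter> Post G {v}))) \<longleftrightarrow>
    \<not> (\<exists>U. invariant_support (star_entry \<A>) (star_entry \<C>) n m U)"
proof -
  note adj = pattern_adjoint_in_patterns[OF \<A>] pattern_adjoint_in_patterns[OF \<C>]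
  have arc_state: "(Suc b, Suc a) \<in> parcs G \<longleftrightarrow> star_entry \<A> b a" if "b < n" "a < n" for a b
    using that star_entry_juxtapose[OF adj, of a b] star_entry_adjoint[OF \<A>, of a b]
    by (auto simp: G pattern_graph_def)
  have arc_out: "(Suc (n + c), Suc a) \<in> parcs G \<longleftrightarrow> star_entry \<C> c a" if "c < m" "a < n" for a c
    using that star_entry_juxtapose[OF adj, of a "n + c"] star_entry_adjoint[OF \<C>, of a c]
    by (auto simp: G pattern_graph_def)
  have sing: "is_singleton (Suc ` U \<inter> Post G {v}) \<longleftrightarrow> (\<exists>!a. a \<in> U \<and> (v, Suc a) \<in> parcs G)" for U v
  proof -
    have "w \<in> Suc ` U \<inter> Post G {v} \<longleftrightarrow> (\<exists>a. (a \<in> U \<and> (v, Suc a) \<in> parcs G) \<and> w = Suc a)" for w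
      by (auto simp: Post_def)
    then show ?thesis unfolding is_singleton_iff_ex1 by (simp only: ex1_image_iff inj_Suc)
  qed
  have state: "is_singleton (Suc ` U \<inter> Post G {Suc b}) \<longleftrightarrow> isolates (star_entry \<A>) b U"
    if "b < n" "U \<subseteq> {..<n}" for b U
  proof -
    have "a \<in> U \<and> (Suc b, Suc a) \<in> parcs G \<longleftrightarrow> a \<in> U \<and> star_entry \<A> b a" for a
      using that arc_state[of b a] by auto
    then show ?thesis unfolding sing isolates_def by simp
  qed
  have out: "is_singleton (Suc ` U \<inter> Post G {Suc (n + c)}) \<longleftrightarrow> isolates (star_entry \<C>) c U"
    if "c < m" "U \<subseteq> {..<n}" for c U
  proof -
    have "a \<in> U \<and> (Suc (n + c), Suc a) \<in> parcs G \<longleftrightarrow> a \<in> U \<and> star_entry \<C> c a" for a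
      using that arc_out[of c a] by auto
    then show ?thesis unfolding sing isolates_def by simp
  qed
  have pre: "Suc ` U \<subseteq> Pre G (Suc ` U) \<longleftrightarrow> (\<forall>b\<in>U. \<exists>a\<in>U. star_entry \<A> b a)"
    if "U \<subseteq> {..<n}" for U
  proof -
    have "Suc ` U \<subseteq> Pre G (Suc ` U) \<longleftrightarrow> (\<forall>b\<in>U. \<exists>a\<in>U. (Suc b, Suc a) \<in> parcs G)"
      by (auto simp: Pre_def)
    also have "\<dots> \<longleftrightarrow> (\<forall>b\<in>U. \<exists>a\<in>U. star_entry \<A> b a)"
      using that arc_state by (intro ball_cong bex_cong refl) auto
    finally show ?thesis .
  qed
  have vertices: "{1..n + m} = Suc ` {..<n} \<union> (\<lambda>c. Suc (n + c)) ` {..<m}"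
  proof (intro Set.set_eqI iffI)
    fix v assume v: "v \<in> {1..n + m}"
    show "v \<in> Suc ` {..<n} \<union> (\<lambda>c. Suc (n + c)) ` {..<m}"
    proof (cases "v \<le> n")
      case True
      then have "v = Suc (v - 1)" "v - 1 < n" using v by auto
      then show ?thesis by blast
    next
      case False
      then have "v = Suc (n + (v - n - 1))" "v - n - 1 < m" using v by auto
      then show ?thesis by blast
    qed
  qed auto
  have a: "(\<exists>v\<in>{1..n + m}. is_singleton (Suc ` U \<inter> Post G {v})) \<longleftrightarrow>
      (\<exists>b<n. isolates (star_entry \<A>) b U) \<or> (\<exists>c<m. isolates (star_entry \<C>) c U)"
    if "U \<subseteq> {..<n}" for U
  proof -
    have "(\<exists>v\<in>{1..n + m}. Q v) \<longleftrightarrow> (\<exists>b<n. Q (Suc b)) \<or> (\<exists>c<m. Q (Suc (n + c)))" for Q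
      unfolding vertices by auto
    then show ?thesis using state[OF _ that] out[OF _ that] by (simp cong: conj_cong)
  qed
  have b: "(\<exists>v\<in>{1..n + m} - Suc ` U. is_singleton (Suc ` U \<inter> Post G {v})) \<longleftrightarrow>
      (\<exists>b<n. b \<notin> U \<and> isolates (star_entry \<A>) b U) \<or> (\<exists>c<m. isolates (star_entry \<C>) c U)"
    if U: "U \<subseteq> {..<n}" for U
  proof -
    have "(\<exists>v\<in>{1..n + m} - Suc ` U. Q v) \<longleftrightarrow>
        (\<exists>b<n. b \<notin> U \<and> Q (Suc b)) \<or> (\<exists>c<m. Q (Suc (n + c)))" for Q
      unfolding vertices using U by auto
    then show ?thesis using state[OF _ U] out[OF _ U] by (simp cong: conj_cong)
  qed
  have sub: "(\<forall>V\<subseteq>{1..n}. P V) \<longleftrightarrow> (\<forall>U\<subseteq>{..<n}. P (Suc ` U))" for P :: "nat set \<Rightarrow> bool"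
    unfolding image_Suc_lessThan[symmetric] by (simp add: all_subset_image)
  have invariant: "invariant_support (star_entry \<A>) (star_entry \<C>) n m U \<longleftrightarrow> U \<subseteq> {..<n} \<and> U \<noteq> {} \<and>
      (\<not> (\<exists>v\<in>{1..n + m}. is_singleton (Suc ` U \<inter> Post G {v})) \<or>
       Suc ` U \<subseteq> Pre G (Suc ` U) \<and>
       \<not> (\<exists>v\<in>{1..n + m} - Suc ` U. is_singleton (Suc ` U \<inter> Post G {v})))" for U
  proof (cases "U \<subseteq> {..<n}")
    case True
    show ?thesis unfolding invariant_support_def a[OF True] b[OF True] pre[OF True] by blast
  qed (simp add: invariant_support_def)
  have logic: "(\<forall>U\<subseteq>S. U \<noteq> {} \<longrightarrow> P U) \<and> (\<forall>U\<subseteq>S. U \<noteq> {} \<and> Q U \<longrightarrow> R U) \<longleftrightarrow>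
      \<not> (\<exists>U. U \<subseteq> S \<and> U \<noteq> {} \<and> (\<not> P U \<or> Q U \<and> \<not> R U))" for S :: "nat set" and P Q R
    by blast
  show ?thesis unfolding sub image_is_empty invariant by (rule logic)
qed

section \<open>From silent supports to unobservable systems and back\<close>

lemma unobserved_response_silent:
  fixes \<A> \<C> :: "'a::real_or_complex mat set"
  assumes \<A>: "\<A> \<in> patterns n n" and \<C>: "\<C> \<in> patterns m n"
    and S: "dt_system n r m A B C D" and AC: "of_output_pattern \<A> \<C> A C"
    and z: "z \<in> carrier_vec n"
    and unobs: "\<And>k. k < N \<Longrightarrow> C (t\<^sub>0 + int k) *\<^sub>v free_response A t\<^sub>0 z k = 0\<^sub>v m"
  shows "silent_supports (star_entry \<A>) (star_entry \<C>) n m N (\<lambda>k. vec_support (free_response A t\<^sub>0 z k))"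
proof -
  define x where "x k = free_response A t\<^sub>0 z k" for k
  have x: "x k \<in> carrier_vec n" for k using free_response_carrier[OF S z] by (simp add: x_def)
  have A: "A t \<in> \<A>" and C: "C t \<in> \<C>" for t using AC by (auto simp: of_output_pattern_def)
  have step: "x (Suc k) = A (t\<^sub>0 + int k) *\<^sub>v x k" for k by (simp add: x_def)
  have "silent_supports (star_entry \<A>) (star_entry \<C>) n m N (\<lambda>k. vec_support (x k))"
    unfolding silent_supports_def
  proof (intro conjI allI impI ballI notI)
    show "vec_support (x k) \<subseteq> {..<n}" for k using x[of k] by (auto simp: vec_support_def)
    show False if "k < N" "c < m" "isolates (star_entry \<C>) c (vec_support (x k))" for k c
      using pattern_mult_isolated[OF \<C> C x that(2,3), of "t\<^sub>0 + int k"] unobs[OF that(1)] that(2)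
      by (simp add: x_def)
    show "b \<in> vec_support (x (Suc k))" if "b < n" "isolates (star_entry \<A>) b (vec_support (x k))" for k b
      using pattern_mult_isolated[OF \<A> A x that, of "t\<^sub>0 + int k"] carrier_vecD[OF x] that(1)
      unfolding vec_support_def step[symmetric] by simp
    show "\<exists>a\<in>vec_support (x k). star_entry \<A> b a" if "b \<in> vec_support (x (Suc k))" for k b
      using pattern_mult_nonzero[OF \<A> A x, of b "t\<^sub>0 + int k" k] carrier_vecD[OF x] that
      unfolding vec_support_def step[symmetric] by simp
  qed
  then show ?thesis by (simp add: x_def)
qed

text \<open>The state at time \<open>t\<^sub>0 + k\<close> is the indicator vector of \<open>V k\<close>. A different matrix of the pattern
  may be needed at each time.\<close>
lemma silent_supports_unobservable:
  fixes \<A> \<C> :: "'a::real_or_complex mat set"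
  assumes \<A>: "\<A> \<in> patterns n n" and \<C>: "\<C> \<in> patterns m n"
    and V: "silent_supports (star_entry \<A>) (star_entry \<C>) n m N V" "k < N" "V k \<noteq> {}"
    and N: "N = nat (t\<^sub>1 - t\<^sub>0)"
  shows "\<exists>A B C D. dt_system n r m A B C D \<and> of_output_pattern \<A> \<C> A C \<and>
    \<not> observable_on n r A B C t\<^sub>0 t\<^sub>1"
proof -
  have "\<exists>X\<in>\<A>. Suc k < N \<longrightarrow> X *\<^sub>v indicator_vec n (V k) = indicator_vec n (V (Suc k))" for k
  proof (cases "Suc k < N")
    case True
    show ?thesis
    proof (rule pattern_realization[OF \<A>, of "V k" "V (Suc k)"])
      show "V k \<subseteq> {..<n}" "V (Suc k) \<subseteq> {..<n}"
        using silent_supports_subset[OF V(1)] True by auto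
      show "\<exists>a\<in>V k. star_entry \<A> i a" if "i \<in> V (Suc k)" for i
        using silent_supports_pred[OF V(1) True that] .
      show "i \<in> V (Suc k)" if "i < n" "isolates (star_entry \<A>) i (V k)" for i
        using silent_supports_step[OF V(1) True that] .
    qed auto
  qed (use patterns_nonempty[OF \<A>] in auto)
  then obtain A' where A': "\<And>k. A' k \<in> \<A>"
    "\<And>k. Suc k < N \<Longrightarrow> A' k *\<^sub>v indicator_vec n (V k) = indicator_vec n (V (Suc k))" by metis
  have "\<exists>X\<in>\<C>. k < N \<longrightarrow> X *\<^sub>v indicator_vec n (V k) = 0\<^sub>v m" for k
  proof (cases "k < N")
    case True
    show ?thesis
      using pattern_annihilation[OF \<C> silent_supports_subset[OF V(1) True]
          silent_supports_output[OF V(1) True]] by blast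
  qed (use patterns_nonempty[OF \<C>] in auto)
  then obtain C' where C': "\<And>k. C' k \<in> \<C>" "\<And>k. k < N \<Longrightarrow> C' k *\<^sub>v indicator_vec n (V k) = 0\<^sub>v m" by metis
  define A where "A t = A' (nat (t - t\<^sub>0))" for t
  define C where "C t = C' (nat (t - t\<^sub>0))" for t
  have S: "dt_system n r m A (\<lambda>_. 0\<^sub>m n r) C (\<lambda>_. 0\<^sub>m m r)"
    using A'(1) C'(1) mem_pattern_iff[OF \<A>] mem_pattern_iff[OF \<C>]
    by (simp add: dt_system_def A_def C_def)
  have P: "of_output_pattern \<A> \<C> A C"
    using A'(1) C'(1) by (simp add: of_output_pattern_def A_def C_def)
  have free: "free_response A t\<^sub>0 (indicator_vec n (V 0)) k = indicator_vec n (V k)" if "k < N" for k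
    using that by (induction k) (simp_all add: A_def A'(2))
  \<comment> \<open>An empty set has only empty successors in a silent sequence, so the initial state is
    nonzero.\<close>
  have "V 0 \<noteq> {}" using silent_supports_initial[OF V(1)] V(2,3) by blast
  then have "indicator_vec n (V 0) \<noteq> (0\<^sub>v n :: 'a vec)"
    using indicator_vec_nonzero[of "V 0" n] silent_supports_subset[OF V(1), of 0] V(2) by auto
  moreover have "C (t\<^sub>0 + int k) *\<^sub>v free_response A t\<^sub>0 (indicator_vec n (V 0)) k = 0\<^sub>v m"
    if "int k < t\<^sub>1 - t\<^sub>0" for k
  proof -
    have "k < N" using that N by auto
    then show ?thesis using free C'(2) by (simp add: C_def)
  qed
  ultimately have "\<not> observable_on n r A (\<lambda>_. 0\<^sub>m n r) C t\<^sub>0 t\<^sub>1"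
    unfolding not_observable_on_iff[OF S] by (intro bexI[of _ "indicator_vec n (V 0)"]) auto
  with S P show ?thesis by blast
qed

lemma all_observable_on_iff:
  fixes \<A> \<C> :: "'a::real_or_complex mat set"
  assumes \<A>: "\<A> \<in> patterns n n" and \<C>: "\<C> \<in> patterns m n" and "t\<^sub>0 < t\<^sub>1"
    and N: "N = nat (t\<^sub>1 - t\<^sub>0)"
  shows "(\<forall>A B C D. dt_system n r m A B C D \<and> of_output_pattern \<A> \<C> A C \<longrightarrow>
      observable_on n r A B C t\<^sub>0 t\<^sub>1) \<longleftrightarrow>
    \<not> (\<exists>V. silent_supports (star_entry \<A>) (star_entry \<C>) n m N V \<and> (\<exists>k<N. V k \<noteq> {}))"
    (is "?O \<longleftrightarrow> \<not> ?S")
proof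
  assume ?O
  then show "\<not> ?S" using silent_supports_unobservable[OF \<A> \<C> _ _ _ N] by blast
next
  assume no: "\<not> ?S"
  show ?O
  proof (intro allI impI, rule ccontr)
    fix A B C D assume S: "dt_system n r m A B C D \<and> of_output_pattern \<A> \<C> A C"
      and "\<not> observable_on n r A B C t\<^sub>0 t\<^sub>1"
    then obtain z where z: "z \<in> carrier_vec n" "z \<noteq> 0\<^sub>v n"
      "\<forall>k. int k < t\<^sub>1 - t\<^sub>0 \<longrightarrow> C (t\<^sub>0 + int k) *\<^sub>v free_response A t\<^sub>0 z k = 0\<^sub>v m"
      using not_observable_on_iff by metis
    have "C (t\<^sub>0 + int k) *\<^sub>v free_response A t\<^sub>0 z k = 0\<^sub>v m" if "k < N" for k
    proof -
      have "int k < t\<^sub>1 - t\<^sub>0" using that N by auto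
      then show ?thesis using z(3) by blast
    qed
    then have "silent_supports (star_entry \<A>) (star_entry \<C>) n m N
        (\<lambda>k. vec_support (free_response A t\<^sub>0 z k))"
      using unobserved_response_silent[OF \<A> \<C> _ _ z(1)] S by blast
    moreover have "vec_support (free_response A t\<^sub>0 z 0) \<noteq> {}"
      using z by (auto simp: vec_support_def vec_eq_iff)
    moreover have "0 < N" using assms by auto
    ultimately show False using no by blast
  qed
qed

text \<open>The indicator vector of \<open>U\<close> is an eigenvector of a suitable \<open>A\<^sub>0\<close> for the eigenvalue 1 or 0,
  so its whole free response consists of unobserved states.\<close>
lemma invariant_support_unobservable:
  fixes \<A> \<C> :: "'a::real_or_complex mat set"
  assumes \<A>: "\<A> \<in> patterns n n" and \<C>: "\<C> \<in> patterns m n"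
    and U: "invariant_support (star_entry \<A>) (star_entry \<C>) n m U"
  shows "\<exists>A B C D. dt_system n r m A B C D \<and> time_invariant A B C D \<and>
    of_output_pattern \<A> \<C> A C \<and> \<not> observable n r A B C"
proof -
  have sub: "U \<subseteq> {..<n}" and ne: "U \<noteq> {}"
    and out: "\<And>c. c < m \<Longrightarrow> \<not> isolates (star_entry \<C>) c U"
    and alt: "(\<forall>b<n. \<not> isolates (star_entry \<A>) b U) \<or>
      (\<forall>b\<in>U. \<exists>a\<in>U. star_entry \<A> b a) \<and> (\<forall>b<n. b \<notin> U \<longrightarrow> \<not> isolates (star_entry \<A>) b U)"
    using U by (auto simp: invariant_support_def)
  obtain C\<^sub>0 where C\<^sub>0: "C\<^sub>0 \<in> \<C>" "C\<^sub>0 *\<^sub>v indicator_vec n U = 0\<^sub>v m"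
    using pattern_annihilation[OF \<C> sub out] by blast
  obtain A\<^sub>0 where A\<^sub>0: "A\<^sub>0 \<in> \<A>" "A\<^sub>0 *\<^sub>v indicator_vec n U \<in> {indicator_vec n U, 0\<^sub>v n}"
    using alt pattern_annihilation[OF \<A> sub] pattern_realization[OF \<A> sub sub]
    by (metis insertCI)
  have carrier: "A\<^sub>0 \<in> carrier_mat n n" "C\<^sub>0 \<in> carrier_mat m n"
    using A\<^sub>0(1) C\<^sub>0(1) mem_pattern_iff[OF \<A>] mem_pattern_iff[OF \<C>] by auto
  have zero: "A\<^sub>0 *\<^sub>v 0\<^sub>v n = 0\<^sub>v n" "C\<^sub>0 *\<^sub>v 0\<^sub>v n = 0\<^sub>v m" using carrier by (auto intro!: eq_vecI)
  have S: "dt_system n r m (\<lambda>_. A\<^sub>0) (\<lambda>_. 0\<^sub>m n r) (\<lambda>_. C\<^sub>0) (\<lambda>_. 0\<^sub>m m r)"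
    using carrier by (simp add: dt_system_def)
  have "free_response (\<lambda>_. A\<^sub>0) \<tau> (indicator_vec n U) k \<in> {indicator_vec n U, 0\<^sub>v n}" for \<tau> k
    by (induction k) (use A\<^sub>0(2) zero in auto)
  then have "C\<^sub>0 *\<^sub>v free_response (\<lambda>_. A\<^sub>0) \<tau> (indicator_vec n U) k = 0\<^sub>v m" for \<tau> k
    using C\<^sub>0(2) zero(2) by (metis empty_iff insert_iff)
  then have "indistinguishable n r (\<lambda>_. A\<^sub>0) (\<lambda>_. 0\<^sub>m n r) (\<lambda>_. C\<^sub>0) \<tau>\<^sub>0 \<tau>\<^sub>1 (indicator_vec n U) (0\<^sub>v n)" for \<tau>\<^sub>0 \<tau>\<^sub>1
    using indistinguishable_iff_free_response[OF S indicator_vec_carrier, of "0\<^sub>v n"] by simp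
  then have "\<not> observable n r (\<lambda>_. A\<^sub>0) (\<lambda>_. 0\<^sub>m n r) (\<lambda>_. C\<^sub>0)"
    unfolding observable_def using indicator_vec_nonzero[OF sub ne]
    by (meson indicator_vec_carrier zero_carrier_vec)
  then show ?thesis using S A\<^sub>0(1) C\<^sub>0(1)
    by (intro exI[of _ "\<lambda>_. A\<^sub>0"] exI[of _ "\<lambda>_. 0\<^sub>m n r"] exI[of _ "\<lambda>_. C\<^sub>0"] exI[of _ "\<lambda>_. 0\<^sub>m m r"])
      (simp add: time_invariant_def of_output_pattern_def)
qed

theorem corollary1:
  fixes \<A> \<C> :: "'a::real_or_complex mat set" and n r m N :: nat and t\<^sub>0 t\<^sub>1 :: int
    and GK GAC :: "nat pair_pre_digraph"
  assumes "n \<ge> 1"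
    and "\<A> \<in> patterns n n" and "\<C> \<in> patterns m n"
    and "t\<^sub>0 < t\<^sub>1"
    and "N = nat (t\<^sub>1 - t\<^sub>0)"
    and "GK = pattern_graph (n * N) ((n + m) * N) (block_pattern n m N \<A> \<C>)"
    and "GAC = pattern_graph n (n + m) (pattern_juxtapose (pattern_adjoint \<A>) (pattern_adjoint \<C>))"
  shows "((\<forall>A B C D. dt_system n r m A B C D \<and> of_output_pattern \<A> \<C> A C \<longrightarrow>
              observable_on n r A B C t\<^sub>0 t\<^sub>1) \<longleftrightarrow>
          condition_G3 (n * N) ((n + m) * N) GK) \<and>
         (t\<^sub>0 + int n \<le> t\<^sub>1 \<longrightarrow>
            (condition_G3 (n * N) ((n + m) * N) GK \<longleftrightarrow>
               (\<forall>A B C D. dt_system n r m A B C D \<and> time_invariant A B C D \<and>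
                  of_output_pattern \<A> \<C> A C \<longrightarrow> observable n r A B C)) \<and>
            (condition_G3 (n * N) ((n + m) * N) GK \<longleftrightarrow>
               (\<forall>V\<subseteq>{1..n}. V \<noteq> {} \<longrightarrow>
                  (\<exists>v\<in>{1..n + m}. is_singleton (V \<inter> Post GAC {v}))) \<and>
               (\<forall>V\<subseteq>{1..n}. V \<noteq> {} \<and> V \<subseteq> Pre GAC V \<longrightarrow>
                  (\<exists>v\<in>{1..n + m} - V. is_singleton (V \<inter> Post GAC {v})))))"
    (is "(?on \<longleftrightarrow> ?G3) \<and> (_ \<longrightarrow> (?G3 \<longleftrightarrow> ?inv) \<and> (?G3 \<longleftrightarrow> ?graph))")
proof -
  have G3: "?G3 \<longleftrightarrow> \<not> (\<exists>V. silent_supports (star_entry \<A>) (star_entry \<C>) n m N V \<and>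
      (\<exists>k<N. V k \<noteq> {}))"
    unfolding assms(6) by (rule condition_G3_iff[OF assms(2,3)])
  have on: "?on \<longleftrightarrow> ?G3"
    unfolding G3 by (rule all_observable_on_iff[OF assms(2-5)])
  have graph: "?graph \<longleftrightarrow> \<not> (\<exists>U. invariant_support (star_entry \<A>) (star_entry \<C>) n m U)"
    by (rule graph_conditions_iff[OF assms(2,3,7)])
  have inv: ?inv if ?on
  proof (intro allI impI)
    fix A B C D assume "dt_system n r m A B C D \<and> time_invariant A B C D \<and> of_output_pattern \<A> \<C> A C"
    then have "observable_on n r A B C t\<^sub>0 t\<^sub>1" using that by blast
    then show "observable n r A B C"
      using \<open>t\<^sub>0 < t\<^sub>1\<close> unfolding observable_def observable_on_def by (meson less_imp_le)
  qed
  have inv_graph: ?graph if ?inv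
    unfolding graph using that invariant_support_unobservable[OF assms(2,3)] by blast
  have graph_G3: ?G3 if ?graph "t\<^sub>0 + int n \<le> t\<^sub>1"
  proof -
    have "n \<le> N" using that(2) assms(5) by simp
    then have no: "\<not> (silent_supports (star_entry \<A>) (star_entry \<C>) n m N V \<and> (\<exists>k<N. V k \<noteq> {}))" for V
      using that(1)[unfolded graph] silent_supports_invariant by blast
    show ?thesis unfolding G3 using no by iprover
  qed
  have G3_inv: ?inv if ?G3 using inv on that by iprover
  show ?thesis
  proof (intro conjI impI)
    show "?on \<longleftrightarrow> ?G3" by (rule on)
    assume N: "t\<^sub>0 + int n \<le> t\<^sub>1"
    show "?G3 \<longleftrightarrow> ?inv"
    proof
      show ?inv if ?G3 using that by (rule G3_inv)
      show ?G3 if ?inv using inv_graph[OF that] N by (rule graph_G3)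
    qed
    show "?G3 \<longleftrightarrow> ?graph"
    proof
      show ?graph if ?G3 using G3_inv[OF that] by (rule inv_graph)
      show ?G3 if ?graph using that N by (rule graph_G3)
    qed
  qed
qed

end
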